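(* Let $N\ge1$ be an integer and $p\in[2,+\infty)$. Let $K:\mathbb{R}^N\times\mathbb{R}^N\to[0,+\infty)$ be a measurable function (not necessarily symmetric) such that (i) there exist $r,R>0$ such that $K(x,y)\ge r$ whenever $|x-y|<R$; (ii) there exists $C_K>0$ such that $\int_{\mathbb{R}^N}K(x,y)\,dy\le C_K$ and $\int_{\mathbb{R}^N}K(y,x)\,dy\le C_K$ for all $x\in\mathbb{R}^N$. Let $\sigma(x):=\int_{\mathbb{R}^N}K(y,x)\,dy$ for $x\in\mathbb{R}^N$, and consider the equation $$\partial_tu(t,x)=\int_{\mathbb{R}^N}K(x,y)\,u(t,y)\,dy-\sigma(x)\,u(t,x),\qquad t\ge0,\ x\in\mathbb{R}^N. \qquad ( * )$$ Assume that there exists an equilibrium $u_\infty$ of $( * )$ satisfying, for some $m>0$, $$\frac1m\le u_\infty(x)\le m\qquad\text{for all }x\in\mathbb{R}^N.$$ Let $u$ be any solution to $( * )$ with initial data $u(0,\cdot)=u_0\in L^1(\mathbb{R}^N)\cap L^p(\mathbb{R}^N)$. Then there exists a constant $C$ depending only on $r$, $R$, $N$, $m$, $p$, $\|u_0\|_1$ and $\|u_0\|_p$ such that $$\|u(t,\cdot)\|_p^p\le C\,(1+t)^{-\frac{N(p-1)}{2}}\qquad\text{for all }t\ge0.$$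
   Context: $\|\cdot\|_q$ denotes the norm of $L^q(\mathbb{R}^N)$. An equilibrium of $( * )$ is a time-independent solution, i.e. a function $u_\infty$ on $\mathbb{R}^N$ with $\int_{\mathbb{R}^N}K(x,y)u_\infty(y)\,dy=\sigma(x)u_\infty(x)$. A solution of $( * )$ with initial data $u_0\in L^1(\mathbb{R}^N)\cap L^p(\mathbb{R}^N)$ is understood as a function $u\in\mathcal{C}^1([0,+\infty),L^p(\mathbb{R}^N)\cap L^1(\mathbb{R}^N))$ satisfying the equation with $u(0,\cdot)=u_0$. *)

theory Defs
  imports "HOL-Analysis.Analysis"
begin

text \<open>Lebesgue spaces of real functions with respect to Lebesgue measure, for real \<open>q \<ge> 1\<close>.
  Members are functions rather than classes modulo null sets, so identities between members are
  stated almost everywhere.\<close>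

definition Lp_space :: "real \<Rightarrow> ('a::euclidean_space \<Rightarrow> real) set" where
  "Lp_space q = {f. f \<in> borel_measurable lebesgue \<and> integrable lebesgue (\<lambda>x. \<bar>f x\<bar> powr q)}"

definition Lp_norm :: "real \<Rightarrow> ('a::euclidean_space \<Rightarrow> real) \<Rightarrow> real" where
  "Lp_norm q f = (LINT x|lebesgue. \<bar>f x\<bar> powr q) powr (1 / q)"

definition is_kernel ::
  "real \<Rightarrow> real \<Rightarrow> real \<Rightarrow> ('a::euclidean_space \<Rightarrow> 'a \<Rightarrow> real) \<Rightarrow> bool" where
  "is_kernel r R CK K \<longleftrightarrow>
     (\<lambda>(x, y). K x y) \<in> borel_measurable lebesgue \<and>
     (\<forall>x y. 0 \<le> K x y) \<and>
     (\<forall>x y. norm (x - y) < R \<longrightarrow> r \<le> K x y) \<and>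
     (\<forall>x. integrable lebesgue (\<lambda>y. K x y) \<and> (LINT y|lebesgue. K x y) \<le> CK) \<and>
     (\<forall>x. integrable lebesgue (\<lambda>y. K y x) \<and> (LINT y|lebesgue. K y x) \<le> CK)"

definition sigma :: "('a::euclidean_space \<Rightarrow> 'a \<Rightarrow> real) \<Rightarrow> 'a \<Rightarrow> real" where
  "sigma K x = (LINT y|lebesgue. K y x)"

text \<open>The integrability clauses below only exclude the default value \<open>0\<close> of the integral of a
  non-integrable function; by the integral bounds on the kernel they hold automatically for
  bounded equilibria and for solutions in \<open>L\<^sup>1\<close>.\<close>

definition is_equilibrium ::
  "('a::euclidean_space \<Rightarrow> 'a \<Rightarrow> real) \<Rightarrow> ('a \<Rightarrow> real) \<Rightarrow> bool" where
  "is_equilibrium K v \<longleftrightarrow>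
     v \<in> borel_measurable lebesgue \<and>
     (AE x in lebesgue. integrable lebesgue (\<lambda>y. K x y * v y) \<and>
        (LINT y|lebesgue. K x y * v y) = sigma K x * v x)"

text \<open>\<open>u \<in> C\<^sup>1([0,\<infinity>), L\<^sup>q)\<close> with derivative \<open>v\<close>; the filter \<open>at t within {0..}\<close> makes the
  derivative and the continuity at \<open>t = 0\<close> one-sided.\<close>

definition C1_Lp ::
  "real \<Rightarrow> (real \<Rightarrow> 'a::euclidean_space \<Rightarrow> real) \<Rightarrow> (real \<Rightarrow> 'a \<Rightarrow> real) \<Rightarrow> bool" where
  "C1_Lp q u v \<longleftrightarrow>
     (\<forall>t\<ge>0. u t \<in> Lp_space q \<and> v t \<in> Lp_space q \<and>
        ((\<lambda>s. Lp_norm q (\<lambda>x. (u s x - u t x) / (s - t) - v t x)) \<longlongrightarrow> 0) (at t within {0..}) \<and>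
        ((\<lambda>s. Lp_norm q (\<lambda>x. v s x - v t x)) \<longlongrightarrow> 0) (at t within {0..}))"

text \<open>Differentiability in \<open>L\<^sup>p \<inter> L\<^sup>1\<close>, normed by the sum of the two norms, is differentiability
  in both spaces with a common derivative.\<close>

definition is_solution ::
  "real \<Rightarrow> ('a::euclidean_space \<Rightarrow> 'a \<Rightarrow> real) \<Rightarrow> ('a \<Rightarrow> real) \<Rightarrow> (real \<Rightarrow> 'a \<Rightarrow> real) \<Rightarrow> bool" where
  "is_solution p K u0 u \<longleftrightarrow>
     (\<exists>v. C1_Lp 1 u v \<and> C1_Lp p u v \<and>
        (\<forall>t\<ge>0. AE x in lebesgue. integrable lebesgue (\<lambda>y. K x y * u t y) \<and>
           v t x = (LINT y|lebesgue. K x y * u t y) - sigma K x * u t x)) \<and>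
     (AE x in lebesgue. u 0 x = u0 x)"

end

theory Submission
  imports Defs
begin

text \<open>The decay comes from the dissipation of the entropy \<open>E = \<integral> e * \<bar>w\<bar> powr p\<close>, where \<open>e\<close> is the equilibrium and
  \<open>w = u / e\<close> is the relative density. Since \<open>\<integral>K(x,y) e(y) dy = \<sigma>(x) e(x)\<close> and \<open>\<sigma>\<close> is the column integral of \<open>K\<close>, the
  kernel \<open>M(x,y) = K(x,y) e(y)\<close> has equal row and column integrals. This balance gives
  \<open>E' = - \<integral>\<integral> M(x,y) D(w(y), w(x))\<close>, where \<open>D\<close> is the Bregman divergence of \<open>\<bar>\<cdot>\<bar> powr p\<close>. With
  \<open>W = \<bar>w\<bar> powr (p/2)\<close> the pointwise inequality \<open>D(b, a) \<ge> (\<bar>b\<bar> powr (p/2) - \<bar>a\<bar> powr (p/2))\<^sup>2\<close> (\<open>bregman_lower\<close>)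
  bounds the dissipation from below by a multiple of \<open>\<integral>\<integral> (W(y) - W(x))\<^sup>2\<close> over \<open>\<bar>x - y\<bar> < R\<close>
  (\<open>entropy_dissipation\<close>, \<open>nonlocal_energy_le_dissipation\<close>).

  The second ingredient is a nonlocal Nash inequality. A translation by \<open>k * z\<close> changes \<open>W\<close> in \<open>L\<^sup>2\<close> by at most \<open>k\<close> times
  as much as a translation by \<open>z\<close>, so averaging over translations in the ball of radius \<open>k * R\<close> bounds \<open>\<integral>W\<^sup>2\<close> by
  \<open>k\<^sup>2\<close> times the Dirichlet form of range \<open>R\<close> plus \<open>k\<close> to the power \<open>-N\<close> times \<open>(\<integral>W)\<^sup>2\<close>, up to constants
  (\<open>nonlocal_nash\<close>). The \<open>L\<^sup>1\<close> norm of \<open>u\<close> does not increase (\<open>L1_norm_nonincreasing\<close>), and \<open>\<integral>W\<close> is interpolated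
  between \<open>\<integral>\<bar>w\<bar>\<close> and \<open>\<integral>\<bar>w\<bar> powr p\<close>. Optimizing in \<open>k\<close> bounds the Dirichlet form below by a multiple of
  \<open>E powr (1 + \<beta>)\<close> with \<open>\<beta> = 2 / (N * (p - 1))\<close> (\<open>nonlocal_nash_powr\<close>). Integrating \<open>E' \<le> - c * E powr (1 + \<beta>)\<close>
  (\<open>power_law_decay\<close>) gives the rate \<open>-1/\<beta>\<close>.

  All integrals are taken for Borel versions of the kernel, the equilibrium and the solution, for which Tonelli's theorem
  on the product of Borel Lebesgue measures applies.\<close>

section \<open>Elementary inequalities for real powers\<close>

lemma powr_tangent_le:
  fixes a b q :: real
  assumes "0 \<le> a" "0 \<le> b" "1 \<le> q"
  shows "a powr q + q * a powr (q - 1) * (b - a) \<le> b powr q"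
proof (cases "a = 0 \<or> b = 0")
  case True
  have "a powr (q - 1) * a = a powr q"
    using assms by (cases "a = 0") (auto simp: powr_mult_base mult.commute)
  then have *: "q * a powr (q - 1) * a = q * a powr q" by simp
  have "a powr q \<le> q * a powr q"
    using assms by (simp add: mult_right_mono[of 1 q, simplified])
  with True assms * show ?thesis by (auto simp: algebra_simps)
next
  case False
  then have ab: "0 < a" "0 < b" using assms by auto
  have "1 + q * (b / a - 1) \<le> (b / a) powr q"
  proof -
    have "\<exists>y. y > 0 \<and> b / a = y" using ab by auto
    then obtain y where y: "y > 0" "b / a = y" by blast
    let ?f = "\<lambda>x. x powr q - q * x"
    have "?f y \<ge> ?f 1"
    proof (cases "y \<le> 1")
      case True
      show ?thesis
      proof (rule DERIV_nonpos_imp_nonincreasing[OF True])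
        fix x assume x: "y \<le> x" "x \<le> 1"
        have "(?f has_real_derivative q * x powr (q - 1) - q) (at x)"
          using x y by (auto intro!: derivative_eq_intros)
        moreover have "x powr (q - 1) \<le> 1"
          using x y assms powr_le1[of "q-1" x] by auto
        then have "q * x powr (q - 1) - q \<le> 0"
          using assms mult_left_mono[of "x powr (q-1)" 1 q] by auto
        ultimately show "\<exists>D. (?f has_real_derivative D) (at x) \<and> D \<le> 0" by blast
      qed
    next
      case False
      then have "1 \<le> y" by simp
      then show ?thesis
      proof (rule DERIV_nonneg_imp_nondecreasing)
        fix x assume x: "1 \<le> x" "x \<le> y"
        have "(?f has_real_derivative q * x powr (q - 1) - q) (at x)"
          using x y by (auto intro!: derivative_eq_intros)
        moreover have "x powr (q - 1) \<ge> 1"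
          using x y assms ge_one_powr_ge_zero[of x "q-1"] by auto
        then have "q * x powr (q - 1) - q \<ge> 0"
          using assms mult_left_mono[of 1 "x powr (q-1)" q] by auto
        ultimately show "\<exists>D. (?f has_real_derivative D) (at x) \<and> 0 \<le> D" by blast
      qed
    qed
    then show ?thesis using y by (simp add: algebra_simps)
  qed
  then have "a powr q * (1 + q * (b / a - 1)) \<le> a powr q * (b / a) powr q"
    by (rule mult_left_mono) simp
  also have "a powr q * (b / a) powr q = b powr q"
    using ab by (simp add: powr_divide)
  also have "a powr q * (1 + q * (b / a - 1)) = a powr q + q * (a powr q / a) * (b - a)"
    using ab by (simp add: field_simps)
  also have "a powr q / a = a powr (q - 1)"
    using ab by (simp add: powr_diff)
  finally show ?thesis .
qed

text \<open>The function \<open>a \<mapsto> \<bar>a\<bar> powr (p - 2) * a\<close>, that is, the derivative of \<open>\<bar>a\<bar> powr p / p\<close>. Defined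
  with the sign function, its absolute value is \<open>\<bar>a\<bar> powr (p - 1)\<close> also at \<open>a = 0\<close>.\<close>

definition dpow :: "real \<Rightarrow> real \<Rightarrow> real" where
  "dpow p a = sgn a * \<bar>a\<bar> powr (p - 1)"

lemma abs_dpow: "\<bar>dpow p a\<bar> = \<bar>a\<bar> powr (p - 1)"
  by (cases "a = 0") (auto simp: dpow_def abs_mult)

lemma dpow_minus: "dpow p (- a) = - dpow p a"
  by (simp add: dpow_def)

text \<open>The Bregman divergence of \<open>\<bar>\<cdot>\<bar> powr p\<close> dominates the squared increment of \<open>\<bar>\<cdot>\<bar> powr (p/2)\<close>. For
  positive \<open>a\<close> and \<open>b\<close> the difference of the two sides is \<open>2 * a powr (p/2)\<close> times the Bregman divergence of the
  convex function \<open>x powr (p/2)\<close>; a negative \<open>b\<close> only helps.\<close>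

lemma bregman_lower:
  fixes a b p :: real
  assumes p: "2 \<le> p"
  shows "(\<bar>b\<bar> powr (p/2) - \<bar>a\<bar> powr (p/2))\<^sup>2 + p * dpow p a * (b - a)
    \<le> \<bar>b\<bar> powr p - \<bar>a\<bar> powr p"
proof -
  have sq: "(x powr (p/2))\<^sup>2 = x powr p" if "0 \<le> x" for x :: real
    using that by (simp add: power2_eq_square flip: powr_add)
  have pos: "(\<bar>b\<bar> powr (p/2) - a powr (p/2))\<^sup>2 + p * dpow p a * (b - a)
    \<le> \<bar>b\<bar> powr p - a powr p" if a: "0 < a" for a b
  proof -
    have "p * dpow p a * (b - a) \<le> p * dpow p a * (\<bar>b\<bar> - a)"
      using a p by (intro mult_left_mono) (auto simp: dpow_def)
    also have "\<dots> = 2 * a powr (p/2) * ((p/2) * a powr (p/2 - 1) * (\<bar>b\<bar> - a))"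
    proof -
      have "a powr (p/2) * a powr (p/2 - 1) = a powr (p - 1)"
        by (simp flip: powr_add)
      then show ?thesis using a by (simp add: dpow_def)
    qed
    also have "\<dots> \<le> 2 * a powr (p/2) * (\<bar>b\<bar> powr (p/2) - a powr (p/2))"
      using powr_tangent_le[of a "\<bar>b\<bar>" "p/2"] a p by (intro mult_left_mono) auto
    finally show ?thesis
      using sq[of a] sq[of "\<bar>b\<bar>"] a by (simp add: power2_diff algebra_simps power2_eq_square)
  qed
  consider "a = 0" | "0 < a" | "a < 0" by linarith
  then show ?thesis
  proof cases
    case 1 then show ?thesis using sq[of "\<bar>b\<bar>"] by (simp add: dpow_def)
  next
    case 2 then show ?thesis using pos[of a b] by simp
  next
    case 3 
    then show ?thesis using pos[of "-a" "-b"] by (simp add: dpow_minus algebra_simps)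
  qed
qed

lemma dpow_diff_le:
  fixes a b p T :: real
  assumes p: "2 \<le> p" and "\<bar>a\<bar> \<le> T" "\<bar>b\<bar> \<le> T" 
  shows "\<bar>dpow p b - dpow p a\<bar> \<le> (p - 1) * T powr (p - 2) * \<bar>b - a\<bar>"
proof -
  have key: "x powr (p - 1) - y powr (p - 1) \<le> (p - 1) * T powr (p - 2) * (x - y)"
    if "0 \<le> y" "y \<le> x" "x \<le> T" for x y
  proof -
    have "x powr (p - 1) - y powr (p - 1) \<le> (p - 1) * x powr (p - 2) * (x - y)"
      using powr_tangent_le[of x y "p - 1"] that p by (simp add: algebra_simps)
    also have "\<dots> \<le> (p - 1) * T powr (p - 2) * (x - y)"
      using that p by (intro mult_right_mono mult_left_mono powr_mono2) auto
    finally show ?thesis .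
  qed
  have base: "x powr (p - 1) \<le> (p - 1) * T powr (p - 2) * x" if "0 \<le> x" "x \<le> T" for x
    using key[of 0 x] that by simp
  consider "0 \<le> a" "0 \<le> b" | "a \<le> 0" "b \<le> 0" | "a < 0" "0 < b" | "0 < a" "b < 0" by linarith
  then show ?thesis
  proof cases
    case 1
    have "dpow p x = x powr (p - 1)" if "0 \<le> x" for x 
      using that by (cases "x = 0") (auto simp: dpow_def)
    then show ?thesis using 1 key[of a b] key[of b a] assms powr_mono2[of "p-1" a b] powr_mono2[of "p-1" b a]
      by (cases "a \<le> b") (auto simp: abs_if)
  next
    case 2
    have "dpow p x = - ((- x) powr (p - 1))" if "x \<le> 0" for x 
      using that by (cases "x = 0") (auto simp: dpow_def)
    then show ?thesis using 2 key[of "-a" "-b"] key[of "-b" "-a"] assms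
        powr_mono2[of "p-1" "-a" "-b"] powr_mono2[of "p-1" "-b" "-a"] abs_le_D2[OF assms(2)] abs_le_D2[OF assms(3)]
      by (cases "a \<le> b") (auto simp: abs_if)
  next
    case 3
    then have "\<bar>dpow p b - dpow p a\<bar> = b powr (p - 1) + (- a) powr (p - 1)"
      by (simp add: dpow_def)
    then show ?thesis using 3 base[of "-a"] base[of b] assms by (simp add: algebra_simps)
  next
    case 4
    then have "\<bar>dpow p b - dpow p a\<bar> = a powr (p - 1) + (- b) powr (p - 1)"
      by (simp add: dpow_def abs_minus_commute)
    then show ?thesis using 4 base[of a] base[of "-b"] assms by (simp add: algebra_simps)
  qed
qed

lemma powr_add_le:
  fixes a b p :: real
  assumes "0 \<le> p" "0 \<le> a" "0 \<le> b"
  shows "(a + b) powr p \<le> 2 powr p * (a powr p + b powr p)"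
proof -
  have "(a + b) powr p \<le> (2 * max a b) powr p"
    using assms by (intro powr_mono2) auto
  also have "\<dots> = 2 powr p * max a b powr p" 
    using assms by (simp add: powr_mult)
  also have "\<dots> \<le> 2 powr p * (a powr p + b powr p)"
    by (intro mult_left_mono) (auto simp: max_def)
  finally show ?thesis .
qed

text \<open>The second-order bound behind the differentiability in time of \<open>\<integral>\<bar>u\<bar> powr p\<close>.\<close>

lemma bregman_upper:
  fixes a d h p :: real
  assumes p: "2 \<le> p" and h: "\<bar>h\<bar> \<le> 1"
  shows "\<bar>a + h * d\<bar> powr p - \<bar>a\<bar> powr p - p * dpow p a * (h * d)
    \<le> p * (p - 1) * 2 powr p * h\<^sup>2 * (\<bar>a\<bar> powr p + \<bar>d\<bar> powr p)"
proof -
  define b where "b = a + h * d"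
  define T where "T = \<bar>a\<bar> + \<bar>d\<bar>"
  have "\<bar>h * d\<bar> \<le> \<bar>d\<bar>" using h mult_right_mono[of "\<bar>h\<bar>" 1 "\<bar>d\<bar>"] by (simp add: abs_mult)
  then have T: "\<bar>a\<bar> \<le> T" "\<bar>b\<bar> \<le> T" "\<bar>d\<bar> \<le> T" "0 \<le> T" by (auto simp: T_def b_def)
  have ba: "b - a = h * d" by (simp add: b_def)
  \<comment> \<open>Convexity at the endpoint \<open>b\<close> bounds the divergence based at \<open>a\<close> by an increment of the derivative.\<close>
  have "p * dpow p b * (a - b) \<le> \<bar>a\<bar> powr p - \<bar>b\<bar> powr p"
    using bregman_lower[OF p, of a b] by (smt (verit) zero_le_power2)
  then have "\<bar>b\<bar> powr p - \<bar>a\<bar> powr p - p * dpow p a * (h * d) \<le> p * ((dpow p b - dpow p a) * (b - a))"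
    unfolding ba[symmetric] by (simp add: algebra_simps)
  also have "\<dots> \<le> p * (\<bar>dpow p b - dpow p a\<bar> * \<bar>b - a\<bar>)"
    using p by (intro mult_left_mono) (auto simp flip: abs_mult)
  also have "\<dots> \<le> p * (((p - 1) * T powr (p - 2) * \<bar>b - a\<bar>) * \<bar>b - a\<bar>)"
    using p dpow_diff_le[OF p T(1,2)] by (intro mult_left_mono mult_right_mono) auto
  also have "\<dots> = p * (p - 1) * h\<^sup>2 * (T powr (p - 2) * \<bar>d\<bar>\<^sup>2)"
    by (simp add: ba power2_eq_square abs_mult mult_ac)
  also have "\<dots> \<le> p * (p - 1) * h\<^sup>2 * (T powr (p - 2) * T\<^sup>2)"
    using p T by (intro mult_left_mono power_mono) auto
  also have "T powr (p - 2) * T\<^sup>2 = T powr p"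
    using T p by (cases "T = 0") (auto simp: powr_diff)
  also have "p * (p - 1) * h\<^sup>2 * T powr p \<le> p * (p - 1) * h\<^sup>2 * (2 powr p * (\<bar>a\<bar> powr p + \<bar>d\<bar> powr p))"
    unfolding T_def using p by (intro mult_left_mono powr_add_le) auto
  finally show ?thesis by (simp add: b_def mult_ac)
qed

text \<open>A weak form of Young's inequality with a free parameter \<open>\<epsilon>\<close>, obtained by comparing \<open>\<bar>d\<bar>\<close> with
  \<open>\<epsilon> * \<bar>a\<bar>\<close>.\<close>

lemma young_split:
  fixes a d \<epsilon> p :: real
  assumes "1 \<le> p" "0 < \<epsilon>"
  shows "\<bar>a\<bar> powr (p - 1) * \<bar>d\<bar> \<le> \<epsilon> * \<bar>a\<bar> powr p + \<epsilon> powr (1 - p) * \<bar>d\<bar> powr p"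
proof (cases "a = 0 \<or> d = 0")
  case True then show ?thesis using assms by auto
next
  case False
  show ?thesis
  proof (cases "\<bar>d\<bar> \<le> \<epsilon> * \<bar>a\<bar>")
    case True
    have "\<bar>a\<bar> powr (p - 1) * \<bar>d\<bar> \<le> \<bar>a\<bar> powr (p - 1) * (\<epsilon> * \<bar>a\<bar>)"
      using True by (intro mult_left_mono) auto
    also have "\<dots> = \<epsilon> * \<bar>a\<bar> powr p" using False by (simp add: powr_diff)
    finally show ?thesis by (smt (verit) mult_nonneg_nonneg powr_ge_zero)
  next
    case F: False
    then have "\<bar>a\<bar> \<le> \<bar>d\<bar> / \<epsilon>" using assms by (simp add: field_simps)
    then have "\<bar>a\<bar> powr (p - 1) * \<bar>d\<bar> \<le> (\<bar>d\<bar> / \<epsilon>) powr (p - 1) * \<bar>d\<bar>"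
      using assms by (intro mult_right_mono powr_mono2) auto
    also have "\<dots> = \<epsilon> powr (1 - p) * \<bar>d\<bar> powr p"
      using False assms by (simp add: powr_divide powr_diff field_simps)
    finally show ?thesis using assms by (smt (verit) mult_nonneg_nonneg powr_ge_zero)
  qed
qed

text \<open>Integrated and used with a suitable threshold \<open>t\<close>, this replaces the interpolation of the \<open>L\<^sup>q\<close> norm
  between \<open>L\<^sup>1\<close> and \<open>L\<^sup>p\<close>.\<close>

lemma powr_interpolate:
  fixes a t p q :: real
  assumes "1 \<le> q" "q \<le> p" "0 < t"
  shows "\<bar>a\<bar> powr q \<le> t powr (q - 1) * \<bar>a\<bar> + t powr (q - p) * \<bar>a\<bar> powr p"
proof (cases "a = 0")
  case True then show ?thesis by simp
next
  case False
  show ?thesis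
  proof (cases "\<bar>a\<bar> \<le> t")
    case True
    have "\<bar>a\<bar> powr q = \<bar>a\<bar> powr (q - 1) * \<bar>a\<bar>" using False by (simp add: powr_diff)
    also have "\<dots> \<le> t powr (q - 1) * \<bar>a\<bar>" 
      using True assms by (intro mult_right_mono powr_mono2) auto
    finally show ?thesis by (smt (verit) mult_nonneg_nonneg powr_ge_zero)
  next
    case F: False
    have "\<bar>a\<bar> powr q = \<bar>a\<bar> powr (q - p) * \<bar>a\<bar> powr p" by (simp flip: powr_add)
    also have "\<dots> \<le> t powr (q - p) * \<bar>a\<bar> powr p" 
      using F assms by (intro mult_right_mono powr_mono2') auto
    finally show ?thesis using assms by (smt (verit) mult_nonneg_nonneg powr_ge_zero)
  qed
qed

section \<open>A differential inequality with power-law decay\<close>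

lemma nonincreasing_of_deriv_within:
  fixes E E' :: "real \<Rightarrow> real"
  assumes deriv: "\<And>t. 0 \<le> t \<Longrightarrow> (E has_real_derivative E' t) (at t within {0..})"
    and le: "\<And>t. 0 \<le> t \<Longrightarrow> E' t \<le> 0"
    and st: "0 \<le> s" "s \<le> t"
  shows "E t \<le> E s"
proof (rule DERIV_nonpos_imp_decreasing_open[OF st(2)])
  fix x assume "s < x" "x < t"
  then have "0 < x" using st by auto
  then show "\<exists>y. (E has_real_derivative y) (at x) \<and> y \<le> 0"
    using deriv[of x] le[of x] by (auto simp: at_within_interior[of x "{0..}"])
next
  have "continuous_on {0..} E"
    using deriv by (meson DERIV_continuous_on atLeast_iff)
  then show "continuous_on {s..t} E"
    by (rule continuous_on_subset) (use st in auto)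
qed

text \<open>The function \<open>E powr (-\<beta>)\<close> has derivative at least \<open>\<beta> * c\<close> as long as \<open>E\<close> is positive.\<close>

lemma power_law_decay:
  fixes E E' :: "real \<Rightarrow> real"
  assumes \<beta>: "0 < \<beta>" and c: "0 < c" and E0: "0 < E0" "E 0 \<le> E0"
    and nonneg: "\<And>t. 0 \<le> t \<Longrightarrow> 0 \<le> E t"
    and deriv: "\<And>t. 0 \<le> t \<Longrightarrow> (E has_real_derivative E' t) (at t within {0..})"
    and le: "\<And>t. 0 \<le> t \<Longrightarrow> E' t \<le> - c * E t powr (1 + \<beta>)"
    and t: "0 \<le> t"
  shows "E t \<le> (min (E0 powr (- \<beta>)) (\<beta> * c)) powr (- 1 / \<beta>) * (1 + t) powr (- 1 / \<beta>)"
proof (cases "E t = 0 \<or> t = 0")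
  case True
  have "E0 = (E0 powr (-\<beta>)) powr (-1/\<beta>)" using E0 \<beta> by (simp add: powr_powr)
  also have "\<dots> \<le> (min (E0 powr (- \<beta>)) (\<beta> * c)) powr (- 1 / \<beta>)"
    using E0 \<beta> c by (intro powr_mono2') auto
  finally show ?thesis using True E0 by auto
next
  case False
  then have Et: "0 < E t" and t0: "0 < t" using nonneg[OF t] t by auto
  have at: "(E has_real_derivative E' s) (at s)" if "0 < s" for s
    using deriv[of s] that by (simp add: at_within_interior[of s "{0..}"])
  have cont: "continuous_on {0..} E"
    using deriv by (meson DERIV_continuous_on atLeast_iff)
  have mono: "E t \<le> E s" if "0 \<le> s" "s \<le> t" for s
  proof (rule nonincreasing_of_deriv_within[OF deriv _ that])
    fix x :: real assume "0 \<le> x"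
    then show "E' x \<le> 0"
      using le[of x] c by (smt (verit) mult_nonneg_nonneg mult_minus_left powr_ge_zero)
  qed
  let ?G = "\<lambda>s. E s powr (-\<beta>) - \<beta> * c * s"
  have "?G 0 \<le> ?G t"
  proof (rule DERIV_nonneg_imp_increasing_open[OF t])
    fix x assume x: "0 < x" "x < t"
    then have Ex: "0 < E x" using mono[of x] Et by auto
    have "(?G has_real_derivative (-\<beta>) * E x powr (-\<beta> - 1) * E' x - \<beta> * c) (at x)"
      using Ex x by (auto intro!: derivative_eq_intros at)
    moreover have "0 \<le> (-\<beta>) * E x powr (-\<beta> - 1) * E' x - \<beta> * c"
    proof -
      have "E x powr (-\<beta> - 1) * E' x \<le> E x powr (-\<beta> - 1) * (- c * E x powr (1 + \<beta>))"
        using le[of x] x by (intro mult_left_mono) auto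
      also have "\<dots> = - c" using Ex by (simp flip: powr_add)
      finally have "\<beta> * (E x powr (-\<beta> - 1) * E' x) \<le> \<beta> * (- c)"
        using \<beta> by (intro mult_left_mono) auto
      then show ?thesis by (simp add: mult.assoc)
    qed
    ultimately show "\<exists>y. (?G has_real_derivative y) (at x) \<and> 0 \<le> y" by blast
  next
    have "continuous_on {0..t} E" using cont by (rule continuous_on_subset) auto
    moreover have "E x \<noteq> 0" if "x \<in> {0..t}" for x using mono[of x] Et that by auto
    ultimately show "continuous_on {0..t} ?G" by (auto intro!: continuous_intros)
  qed
  moreover have "E0 powr (-\<beta>) \<le> E 0 powr (-\<beta>)"
    using E0 mono[of 0] Et t \<beta> by (intro powr_mono2') auto
  ultimately have "E0 powr (-\<beta>) + \<beta> * c * t \<le> E t powr (-\<beta>)" by simp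
  moreover have "min (E0 powr (- \<beta>)) (\<beta> * c) * (1 + t) \<le> E0 powr (-\<beta>) + \<beta> * c * t"
    unfolding distrib_left mult_1_right 
    using t by (intro add_mono mult_right_mono) auto
  ultimately have *: "min (E0 powr (- \<beta>)) (\<beta> * c) * (1 + t) \<le> E t powr (-\<beta>)" by linarith
  have "E t = (E t powr (-\<beta>)) powr (-1/\<beta>)" using Et \<beta> by (simp add: powr_powr)
  also have "\<dots> \<le> (min (E0 powr (- \<beta>)) (\<beta> * c) * (1 + t)) powr (-1/\<beta>)"
    using * t E0 c \<beta> by (intro powr_mono2') auto
  also have "\<dots> = (min (E0 powr (- \<beta>)) (\<beta> * c)) powr (- 1 / \<beta>) * (1 + t) powr (- 1 / \<beta>)"
    by (rule powr_mult)
  finally show ?thesis .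
qed

section \<open>A nonlocal Nash inequality\<close>

lemma sets_borel_ball [measurable]: "ball (c::'a::metric_space) r \<in> sets borel"
  by simp

lemma nn_integral_lborel_translate:
  fixes f :: "'a::euclidean_space \<Rightarrow> ennreal"
  assumes [measurable]: "f \<in> borel_measurable borel"
  shows "(\<integral>\<^sup>+x. f (c + x) \<partial>lborel) = (\<integral>\<^sup>+x. f x \<partial>lborel)"
  by (subst (2) lborel_distr_plus[of c, symmetric]) (simp add: nn_integral_distr)

lemma nn_integral_lborel_scale:
  fixes f :: "'a::euclidean_space \<Rightarrow> ennreal"
  assumes [measurable]: "f \<in> borel_measurable borel" and c: "0 < c"
  shows "(\<integral>\<^sup>+x. f x \<partial>lborel) = ennreal (c ^ DIM('a)) * (\<integral>\<^sup>+x. f (c *\<^sub>R x) \<partial>lborel)"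
  using c by (subst lborel_affine[of c 0])
    (simp_all add: nn_integral_density nn_integral_distr nn_integral_cmult ennreal_power)

text \<open>The squared \<open>L\<^sup>2\<close> distance between \<open>W\<close> and its translate by \<open>z\<close>. Values are extended nonnegative reals,
  so that no integrability is needed before it is known.\<close>

definition shift_energy :: "('a::euclidean_space \<Rightarrow> real) \<Rightarrow> 'a \<Rightarrow> ennreal" where
  "shift_energy W z = (\<integral>\<^sup>+x. ennreal ((W (x + z) - W x)\<^sup>2) \<partial>lborel)"

text \<open>The Dirichlet form \<open>\<integral>\<integral> (W y - W x)\<^sup>2\<close> over the pairs at distance less than \<open>R\<close>.\<close>

definition nonlocal_energy :: "real \<Rightarrow> ('a::euclidean_space \<Rightarrow> real) \<Rightarrow> ennreal" where
  "nonlocal_energy R W = (\<integral>\<^sup>+z. indicator (ball 0 R) z * shift_energy W z \<partial>lborel)"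

lemma borel_measurable_shift_energy [measurable]:
  assumes [measurable]: "W \<in> borel_measurable borel"
  shows "shift_energy W \<in> borel_measurable borel"
  unfolding shift_energy_def by measurable

text \<open>A translation by \<open>k\<close> times \<open>z\<close> is a chain of \<open>k\<close> translations by \<open>z\<close>; the Cauchy-Schwarz inequality costs one
  more factor \<open>k\<close>.\<close>

lemma shift_energy_scaleR_le:
  fixes W :: "'a::euclidean_space \<Rightarrow> real"
  assumes [measurable]: "W \<in> borel_measurable borel"
  shows "shift_energy W (real k *\<^sub>R z) \<le> ennreal ((real k)\<^sup>2) * shift_energy W z"
proof -
  let ?d = "\<lambda>i x. W (x + real (Suc i) *\<^sub>R z) - W (x + real i *\<^sub>R z)"
  have pw: "(W (x + real k *\<^sub>R z) - W x)\<^sup>2 \<le> (\<Sum>i<k. real k * (?d i x)\<^sup>2)" for x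
  proof -
    have "W (x + real k *\<^sub>R z) - W x = (\<Sum>i<k. ?d i x)"
      using sum_lessThan_telescope[of "\<lambda>i. W (x + real i *\<^sub>R z)" k] by simp
    also have "(\<Sum>i<k. ?d i x)\<^sup>2 \<le> (\<Sum>i<k. (?d i x)\<^sup>2) * card {..<k}"
      by (rule sum_squared_le_sum_of_squares)
    also have "\<dots> = (\<Sum>i<k. real k * (?d i x)\<^sup>2)"
      by (simp add: sum_distrib_left mult.commute)
    finally show ?thesis .
  qed
  have tr: "(\<integral>\<^sup>+x. ennreal ((?d i x)\<^sup>2) \<partial>lborel) = shift_energy W z" for i
    using nn_integral_lborel_translate[of "\<lambda>x. ennreal ((W (x + z) - W x)\<^sup>2)" "real i *\<^sub>R z"]
    by (simp add: shift_energy_def algebra_simps)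
  have "shift_energy W (real k *\<^sub>R z) \<le> (\<integral>\<^sup>+x. ennreal (\<Sum>i<k. real k * (?d i x)\<^sup>2) \<partial>lborel)"
    unfolding shift_energy_def by (intro nn_integral_mono ennreal_leI pw)
  also have "\<dots> = (\<integral>\<^sup>+x. (\<Sum>i<k. ennreal (real k) * ennreal ((?d i x)\<^sup>2)) \<partial>lborel)"
    by (simp add: ennreal_mult flip: sum_ennreal)
  also have "\<dots> = (\<Sum>i<k. ennreal (real k) * (\<integral>\<^sup>+x. ennreal ((?d i x)\<^sup>2) \<partial>lborel))"
    by (subst nn_integral_sum) (auto simp: nn_integral_cmult)
  also have "\<dots> = ennreal (real k) * (ennreal (real k) * shift_energy W z)"
    by (simp only: tr sum_constant card_lessThan) (simp add: ennreal_of_nat_eq_real_of_nat)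
  also have "\<dots> = ennreal ((real k)\<^sup>2) * shift_energy W z"
    by (simp add: power2_eq_square ennreal_mult mult.assoc)
  finally show ?thesis .
qed

lemma nonlocal_energy_scale_le:
  fixes W :: "'a::euclidean_space \<Rightarrow> real"
  assumes [measurable]: "W \<in> borel_measurable borel" and k: "1 \<le> k"
  shows "nonlocal_energy (real k * R) W \<le> ennreal (real k ^ (DIM('a) + 2)) * nonlocal_energy R W"
proof -
  have ind: "indicator (ball 0 (real k * R)) (real k *\<^sub>R z) = (indicator (ball 0 R) z :: ennreal)" for z :: 'a
    using k by (auto simp: indicator_def)
  have "nonlocal_energy (real k * R) W = ennreal (real k ^ DIM('a)) *
      (\<integral>\<^sup>+z. indicator (ball 0 R) z * shift_energy W (real k *\<^sub>R z) \<partial>lborel)"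
    unfolding nonlocal_energy_def using k by (subst nn_integral_lborel_scale[of _ "real k"]) (simp_all add: ind)
  also have "\<dots> \<le> ennreal (real k ^ DIM('a)) *
      (\<integral>\<^sup>+z. ennreal ((real k)\<^sup>2) * (indicator (ball 0 R) z * shift_energy W z) \<partial>lborel)"
    by (intro mult_left_mono nn_integral_mono)
       (auto simp: indicator_def shift_energy_scaleR_le)
  also have "\<dots> = ennreal (real k ^ DIM('a)) * (ennreal ((real k)\<^sup>2) * nonlocal_energy R W)"
    unfolding nonlocal_energy_def by (subst nn_integral_cmult) auto
  also have "\<dots> = ennreal (real k ^ (DIM('a) + 2)) * nonlocal_energy R W"
    by (simp add: power_add power2_eq_square ennreal_mult mult_ac)
  finally show ?thesis .
qed

text \<open>Expand the square in \<open>shift_energy\<close> and integrate over the translations in a ball of radius \<open>L\<close>: the integral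
  of \<open>W x * W (x + z)\<close> is at most the square of the \<open>L\<^sup>1\<close> norm.\<close>

lemma nonlocal_nash_scale:
  fixes W :: "'a::euclidean_space \<Rightarrow> real"
  assumes [measurable]: "W \<in> borel_measurable borel" and W: "\<And>x. 0 \<le> W x"
  shows "2 * emeasure lborel (ball (0::'a) L) * (\<integral>\<^sup>+x. ennreal ((W x)\<^sup>2) \<partial>lborel)
    \<le> nonlocal_energy L W + 2 * (\<integral>\<^sup>+x. ennreal (W x) \<partial>lborel)\<^sup>2"
proof -
  let ?P = "\<integral>\<^sup>+x. ennreal ((W x)\<^sup>2) \<partial>lborel" and ?A = "\<integral>\<^sup>+x. ennreal (W x) \<partial>lborel"
  let ?B = "\<lambda>z. indicator (ball (0::'a) L) z :: ennreal"
  define c where "c z = (\<integral>\<^sup>+x. ennreal (W x) * ennreal (W (x + z)) \<partial>lborel)" for z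
  have [measurable]: "c \<in> borel_measurable borel" unfolding c_def by measurable
  have tr: "(\<integral>\<^sup>+x. ennreal ((W (x + z))\<^sup>2) \<partial>lborel) = ?P" for z
    using nn_integral_lborel_translate[of "\<lambda>x. ennreal ((W x)\<^sup>2)" z] by (simp add: add.commute)
  have tr': "(\<integral>\<^sup>+z. ennreal (W (x + z)) \<partial>lborel) = ?A" for x
    using nn_integral_lborel_translate[of "\<lambda>x. ennreal (W x)" x] by simp
  have "ennreal ((W x)\<^sup>2) + ennreal ((W (x + z))\<^sup>2) = 
      ennreal ((W (x + z) - W x)\<^sup>2) + 2 * (ennreal (W x) * ennreal (W (x + z)))" for x z
  proof -
    have "ennreal ((W x)\<^sup>2) + ennreal ((W (x + z))\<^sup>2) = ennreal ((W x)\<^sup>2 + (W (x + z))\<^sup>2)"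
      by simp
    also have "(W x)\<^sup>2 + (W (x + z))\<^sup>2 = (W (x + z) - W x)\<^sup>2 + 2 * (W x * W (x + z))"
      by (simp add: power2_eq_square algebra_simps)
    also have "ennreal \<dots> = ennreal ((W (x + z) - W x)\<^sup>2) + 2 * (ennreal (W x) * ennreal (W (x + z)))"
      using W by (simp add: ennreal_mult ennreal_plus)
    finally show ?thesis .
  qed
  then have "(\<integral>\<^sup>+x. ennreal ((W x)\<^sup>2) + ennreal ((W (x + z))\<^sup>2) \<partial>lborel)
      = (\<integral>\<^sup>+x. ennreal ((W (x + z) - W x)\<^sup>2) + 2 * (ennreal (W x) * ennreal (W (x + z))) \<partial>lborel)" for z
    by (intro nn_integral_cong) auto
  then have eq: "?P + ?P = shift_energy W z + 2 * c z" for z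
    by (simp add: nn_integral_add nn_integral_cmult tr shift_energy_def c_def)
  have eq': "?B z * (?P + ?P) = ?B z * shift_energy W z + 2 * (?B z * c z)" for z
    unfolding eq[of z] by (simp add: distrib_left mult_ac)
  have "2 * emeasure lborel (ball (0::'a) L) * ?P = (\<integral>\<^sup>+z. ?B z * (?P + ?P) \<partial>lborel)"
    by (subst nn_integral_multc) (auto simp: mult_2 distrib_left distrib_right)
  also have "\<dots> = (\<integral>\<^sup>+z. ?B z * shift_energy W z + 2 * (?B z * c z) \<partial>lborel)"
    by (intro nn_integral_cong) (rule eq')
  also have "\<dots> = nonlocal_energy L W + 2 * (\<integral>\<^sup>+z. ?B z * c z \<partial>lborel)"
    by (simp add: nn_integral_add nn_integral_cmult nonlocal_energy_def)
  also have "\<dots> \<le> nonlocal_energy L W + 2 * (\<integral>\<^sup>+z. c z \<partial>lborel)"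
    by (intro add_left_mono mult_left_mono nn_integral_mono) (auto simp: indicator_def)
  also have "(\<integral>\<^sup>+z. c z \<partial>lborel) = (\<integral>\<^sup>+x. (\<integral>\<^sup>+z. ennreal (W x) * ennreal (W (x + z)) \<partial>lborel) \<partial>lborel)"
    unfolding c_def by (rule lborel_pair.Fubini') measurable
  also have "\<dots> = ?A\<^sup>2"
    by (simp add: nn_integral_cmult tr' nn_integral_multc power2_eq_square)
  finally show ?thesis .
qed

text \<open>The previous inequality for \<open>L = k * R\<close>, with the energy brought back to the range \<open>R\<close> and both sides divided
  by \<open>k ^ DIM('a)\<close>.\<close>

lemma nonlocal_nash:
  fixes W :: "'a::euclidean_space \<Rightarrow> real"
  assumes "W \<in> borel_measurable borel" "\<And>x. 0 \<le> W x" 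
    and k: "1 \<le> k" and R: "0 < R"
    and P: "(\<integral>\<^sup>+x. ennreal ((W x)\<^sup>2) \<partial>lborel) = ennreal P" "0 \<le> P" 
    and A: "(\<integral>\<^sup>+x. ennreal (W x) \<partial>lborel) \<le> ennreal A" "0 \<le> A"
    and D: "nonlocal_energy R W \<le> ennreal D" "0 \<le> D"
  shows "2 * measure lborel (ball (0::'a) R) * P \<le> (real k)\<^sup>2 * D + 2 * A\<^sup>2 / real k ^ DIM('a)"
proof -
  let ?n = "DIM('a)" and ?V = "measure lborel (ball (0::'a) R)"
  have kpos: "0 < real k ^ ?n" using k by simp
  have em: "emeasure lborel (ball (0::'a) (real k * R)) = ennreal (real k ^ ?n * ?V)"
  proof -
    have "emeasure lborel (ball (0::'a) (real k * R)) = (\<integral>\<^sup>+x. indicator (ball (0::'a) (real k * R)) x \<partial>lborel)"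
      by simp
    also have "\<dots> = ennreal (real k ^ ?n) * (\<integral>\<^sup>+x. indicator (ball (0::'a) (real k * R)) (real k *\<^sub>R x) \<partial>lborel)"
      using k by (intro nn_integral_lborel_scale) auto
    also have "(\<lambda>x::'a. indicator (ball 0 (real k * R)) (real k *\<^sub>R x) :: ennreal) = indicator (ball 0 R)"
      using k by (auto simp: indicator_def fun_eq_iff)
    also have "(\<integral>\<^sup>+x. indicator (ball (0::'a) R) x \<partial>lborel) = ennreal ?V"
      using emeasure_lborel_ball_finite[of "0::'a" R] by (simp add: emeasure_eq_ennreal_measure)
    finally show ?thesis by (simp add: ennreal_mult)
  qed
  have "ennreal (2 * (real k ^ ?n * ?V) * P) = 2 * ennreal (real k ^ ?n * ?V) * ennreal P"
    using P by (simp add: ennreal_mult)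
  also have "\<dots> \<le> nonlocal_energy (real k * R) W + 2 * (\<integral>\<^sup>+x. ennreal (W x) \<partial>lborel)\<^sup>2"
    unfolding P(1)[symmetric] em[symmetric] by (rule nonlocal_nash_scale[OF assms(1,2)])
  also have "\<dots> \<le> ennreal (real k ^ (?n + 2)) * ennreal D + 2 * (ennreal A)\<^sup>2"
    by (intro add_mono mult_left_mono power_mono A order_trans[OF nonlocal_energy_scale_le[OF assms(1) k]] D) auto
  also have "\<dots> = ennreal (real k ^ (?n + 2) * D + 2 * A\<^sup>2)"
    using A D by (simp add: ennreal_mult power2_eq_square ennreal_plus)
  finally have "2 * (real k ^ ?n * ?V) * P \<le> real k ^ (?n + 2) * D + 2 * A\<^sup>2"
    using A D by (subst (asm) ennreal_le_iff) auto
  then have "real k ^ ?n * (2 * ?V * P) \<le> real k ^ ?n * ((real k)\<^sup>2 * D + 2 * A\<^sup>2 / real k ^ ?n)"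
    using kpos by (simp add: power_add power2_eq_square algebra_simps)
  then show ?thesis using kpos by simp
qed

text \<open>The Nash inequality for \<open>\<bar>w\<bar> powr (p/2)\<close>, in terms of the \<open>L\<^sup>1\<close> norm of \<open>w\<close>. Averaging reaches only scales
  above \<open>R\<close>, so an upper bound \<open>P0\<close> for \<open>P\<close> enters the constant: it ensures that the scale
  chosen in the proof is at least \<open>R\<close>.\<close>

lemma nonlocal_nash_powr:
  fixes w :: "'a::euclidean_space \<Rightarrow> real"
  defines "n \<equiv> real DIM('a)" and "V \<equiv> \<lambda>R. measure lborel (ball (0::'a) R)"
  assumes [measurable]: "w \<in> borel_measurable borel" and p: "2 \<le> p" and R: "0 < R"
    and A: "integrable lborel w" "(\<integral>x. \<bar>w x\<bar> \<partial>lborel) \<le> A"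
    and P: "integrable lborel (\<lambda>x. \<bar>w x\<bar> powr p)" "P = (\<integral>x. \<bar>w x\<bar> powr p \<partial>lborel)" "P \<le> P0" 
    and c: "c = max ((2 * (A + 1)\<^sup>2 / V R) powr (1 / n)) (P0 powr (1 / (n * (p - 1))))"
    and D: "nonlocal_energy R (\<lambda>x. \<bar>w x\<bar> powr (p/2)) \<le> ennreal D" "0 \<le> D"
  shows "V R / (4 * c\<^sup>2) * P powr (1 + 2 / (n * (p - 1))) \<le> D"
proof (cases "P = 0")
  case True then show ?thesis using D by simp
next
  case False
  have P0: "0 \<le> P" unfolding P by (rule integral_nonneg_AE) auto
  with False have Ppos: "0 < P" by simp
  have A0: "0 \<le> A" using A(2) by (rule order_trans[rotated]) auto
  have Vpos: "0 < V R" unfolding V_def using R by (rule content_ball_pos)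
  have n: "0 < n" unfolding n_def by simp
  define l where "l = (p/2 - 1) / (p - 1)"
  define Q where "Q = P powr (- 1 / (p - 1))"
  have l2: "P powr l * P powr l = P * Q"
  proof -
    have "l + l = (p - 1 - 1) / (p - 1)"
      unfolding l_def by (simp flip: add_divide_distrib)
    also have "\<dots> = 1 + (- 1 / (p - 1))" using p by (subst diff_divide_distrib) simp
    finally have "l + l = 1 + (- 1 / (p - 1))" .
    then have "P powr l * P powr l = P powr (1 + (- 1 / (p - 1)))"
      by (simp only: powr_add[symmetric])
    then show ?thesis using Ppos unfolding Q_def by (simp only: powr_add) simp
  qed
  have nnA: "(\<integral>\<^sup>+x. ennreal \<bar>w x\<bar> \<partial>lborel) = ennreal (\<integral>x. \<bar>w x\<bar> \<partial>lborel)"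
    using A by (intro nn_integral_eq_integral) auto
  have nnP: "(\<integral>\<^sup>+x. ennreal (\<bar>w x\<bar> powr p) \<partial>lborel) = ennreal P"
    unfolding P(2) using P(1) by (intro nn_integral_eq_integral) auto
  have intW: "(\<integral>\<^sup>+x. ennreal (\<bar>w x\<bar> powr (p/2)) \<partial>lborel) \<le> ennreal ((A + 1) * P powr l)"
  proof -
    \<comment> \<open>With this threshold both terms of the interpolation are multiples of the same power of \<open>P\<close>.\<close>
    let ?t = "P powr (1 / (p - 1))"
    have e1: "?t powr (p/2 - 1) = P powr l" by (simp add: powr_powr l_def)
    have e2: "?t powr (p/2 - p) * P = P powr l"
    proof -
      have "?t powr (p/2 - p) * P = P powr (1 / (p - 1) * (p/2 - p)) * P powr 1"
        using Ppos by (simp add: powr_powr)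
      also have "\<dots> = P powr (1 / (p - 1) * (p/2 - p) + 1)" by (simp only: powr_add)
      also have "1 / (p - 1) * (p/2 - p) + 1 = (p/2 - p) / (p - 1) + (p - 1) / (p - 1)"
        using p by simp
      also have "\<dots> = ((p/2 - p) + (p - 1)) / (p - 1)"
        by (simp only: add_divide_distrib)
      also have "(p/2 - p) + (p - 1) = p/2 - 1" by simp
      also have "(p/2 - 1) / (p - 1) = l" by (simp add: l_def)
      finally show ?thesis .
    qed
    have "(\<integral>\<^sup>+x. ennreal (\<bar>w x\<bar> powr (p/2)) \<partial>lborel)
       \<le> (\<integral>\<^sup>+x. ennreal (?t powr (p/2 - 1)) * ennreal \<bar>w x\<bar> + ennreal (?t powr (p/2 - p)) * ennreal (\<bar>w x\<bar> powr p) \<partial>lborel)"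
      using powr_interpolate[of "p/2" p ?t] p Ppos
      by (intro nn_integral_mono) (auto simp flip: ennreal_mult ennreal_plus intro!: ennreal_leI)
    also have "\<dots> = ennreal (?t powr (p/2 - 1)) * ennreal (\<integral>x. \<bar>w x\<bar> \<partial>lborel) + ennreal (?t powr (p/2 - p)) * ennreal P"
      by (simp add: nn_integral_add nn_integral_cmult nnA nnP)
    also have "\<dots> = ennreal (?t powr (p/2 - 1) * (\<integral>x. \<bar>w x\<bar> \<partial>lborel) + ?t powr (p/2 - p) * P)"
      using Ppos by (simp add: ennreal_mult ennreal_plus)
    also have "\<dots> \<le> ennreal ((A + 1) * P powr l)"
      unfolding e1 e2 using mult_left_mono[OF A(2), of "P powr l"]
      by (intro ennreal_leI) (simp add: algebra_simps)
    finally show ?thesis .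
  qed
  \<comment> \<open>At scales \<open>k \<ge> X\<close> the \<open>L\<^sup>1\<close> term of the Nash inequality is at most half of the left-hand side.\<close>
  define X where "X = c * Q powr (1 / n)"
  have Qpos: "0 < Q" using Ppos by (simp add: Q_def)
  have X1: "1 \<le> X"
  proof -
    have "1 = (P powr (1 / (p - 1))) powr (1 / n) * Q powr (1 / n)"
      unfolding Q_def powr_powr using Ppos by (simp flip: powr_add)
    also have "\<dots> \<le> P0 powr (1 / (n * (p - 1))) * Q powr (1 / n)"
      using p n P Ppos by (intro mult_right_mono) (auto simp: powr_powr mult.commute intro!: powr_mono2)
    also have "\<dots> \<le> X" unfolding X_def c by (intro mult_right_mono) auto
    finally show ?thesis .
  qed
  define k where "k = nat \<lceil>X\<rceil>"
  have k: "1 \<le> k" "X \<le> real k" "real k \<le> 2 * X"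
    using X1 by (auto simp: k_def) linarith+
  have kn: "2 * (A + 1)\<^sup>2 / V R * Q \<le> real k ^ DIM('a)"
  proof -
    have "2 * (A + 1)\<^sup>2 / V R * Q = ((2 * (A + 1)\<^sup>2 / V R * Q) powr (1 / n)) powr n"
      using n A0 Vpos Qpos by (simp add: powr_powr)
    also have "(2 * (A + 1)\<^sup>2 / V R * Q) powr (1 / n) = (2 * (A + 1)\<^sup>2 / V R) powr (1 / n) * Q powr (1 / n)"
      by (rule powr_mult)
    also have "(\<dots>) powr n \<le> X powr n"
      unfolding X_def c using n by (intro powr_mono2 mult_right_mono) auto
    also have "\<dots> \<le> real k powr n" using k X1 n by (intro powr_mono2) auto
    also have "\<dots> = real k ^ DIM('a)" using k unfolding n_def by (subst powr_realpow) auto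
    finally show ?thesis .
  qed
  have "2 * V R * P \<le> (real k)\<^sup>2 * D + 2 * ((A + 1) * P powr l)\<^sup>2 / real k ^ DIM('a)"
    unfolding V_def
  proof (rule nonlocal_nash[OF _ _ k(1) R _ P0 intW _ D])
    have "(\<bar>w x\<bar> powr (p/2))\<^sup>2 = \<bar>w x\<bar> powr p" for x
      by (simp add: power2_eq_square flip: powr_add)
    then show "(\<integral>\<^sup>+x. ennreal ((\<bar>w x\<bar> powr (p/2))\<^sup>2) \<partial>lborel) = ennreal P"
      by (simp add: nnP)
  qed (use A0 in auto)
  also have "2 * ((A + 1) * P powr l)\<^sup>2 / real k ^ DIM('a) \<le> V R * P"
  proof -
    have "2 * ((A + 1) * P powr l)\<^sup>2 = 2 * (A + 1)\<^sup>2 * (P powr l * P powr l)" 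
      by (simp add: power2_eq_square)
    also have "\<dots> = (2 * (A + 1)\<^sup>2 / V R * Q) * (V R * P)"
      using Vpos unfolding l2 by simp
    also have "\<dots> \<le> real k ^ DIM('a) * (V R * P)"
      using Vpos Ppos kn by (intro mult_right_mono) auto
    finally show ?thesis using k by (simp add: divide_le_eq mult.commute)
  qed
  finally have "V R * P \<le> (real k)\<^sup>2 * D" by (simp add: mult.commute)
  also have "\<dots> \<le> (2 * X)\<^sup>2 * D" 
    by (rule mult_right_mono[OF power_mono[OF k(3) of_nat_0_le_iff] D(2)])
  finally have *: "V R * P \<le> 4 * X\<^sup>2 * D" by (simp add: power_mult_distrib)
  have "P powr (1 + 2 / (n * (p - 1))) * (Q powr (1 / n))\<^sup>2 = P"
  proof -
    have "(Q powr (1 / n))\<^sup>2 = P powr (- (2 / (n * (p - 1))))"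
      unfolding Q_def using n p by (simp add: powr_powr power2_eq_square flip: powr_add)
    then show ?thesis using Ppos by (simp flip: powr_add)
  qed
  then have "V R / (4 * c\<^sup>2) * P powr (1 + 2 / (n * (p - 1))) * (4 * X\<^sup>2) = V R * P" 
    using X1 unfolding X_def by (cases "c = 0") (auto simp: power_mult_distrib field_simps)
  with * have "V R / (4 * c\<^sup>2) * P powr (1 + 2 / (n * (p - 1))) * (4 * X\<^sup>2) \<le> D * (4 * X\<^sup>2)"
    by (simp add: mult_ac)
  then show ?thesis using X1 by (subst (asm) mult_le_cancel_right_pos) auto
qed

section \<open>Integrals of powers along differentiable curves\<close>

lemma integrable_abs_powr_diff:
  fixes f g :: "'a \<Rightarrow> real"
  assumes [measurable]: "f \<in> borel_measurable M" "g \<in> borel_measurable M"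
    and "0 \<le> p" "integrable M (\<lambda>x. \<bar>f x\<bar> powr p)" "integrable M (\<lambda>x. \<bar>g x\<bar> powr p)"
  shows "integrable M (\<lambda>x. \<bar>f x - g x\<bar> powr p)"
proof (rule Bochner_Integration.integrable_bound)
  show "integrable M (\<lambda>x. 2 powr p * (\<bar>f x\<bar> powr p + \<bar>g x\<bar> powr p))"
    using assms by auto
  have "\<bar>f x - g x\<bar> powr p \<le> 2 powr p * (\<bar>f x\<bar> powr p + \<bar>g x\<bar> powr p)" for x
    using assms by (intro order_trans[OF powr_mono2 powr_add_le]) auto
  then show "AE x in M. norm (\<bar>f x - g x\<bar> powr p) \<le> norm (2 powr p * (\<bar>f x\<bar> powr p + \<bar>g x\<bar> powr p))"
    by (intro AE_I2) (smt (verit) real_norm_def powr_ge_zero)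
qed measurable

lemma borel_measurable_dpow [measurable]:
  assumes [measurable]: "f \<in> borel_measurable M"
  shows "(\<lambda>x. dpow p (f x)) \<in> borel_measurable M"
  unfolding dpow_def sgn_real_def by measurable

lemma integrable_dpow_mult:
  fixes f g :: "'a \<Rightarrow> real"
  assumes [measurable]: "f \<in> borel_measurable M" "g \<in> borel_measurable M"
    and "1 \<le> p" "integrable M (\<lambda>x. \<bar>f x\<bar> powr p)" "integrable M (\<lambda>x. \<bar>g x\<bar> powr p)"
  shows "integrable M (\<lambda>x. dpow p (f x) * g x)"
proof (rule Bochner_Integration.integrable_bound)
  show "integrable M (\<lambda>x. \<bar>f x\<bar> powr p + \<bar>g x\<bar> powr p)"
    using assms by auto
  show "AE x in M. norm (dpow p (f x) * g x) \<le> norm (\<bar>f x\<bar> powr p + \<bar>g x\<bar> powr p)"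
    using young_split[of p 1] assms by (simp add: abs_mult abs_dpow)
qed measurable

text \<open>The chain rule for \<open>\<integral>\<rho> * \<bar>U\<bar> powr p\<close> along a curve with derivative \<open>V\<close> in \<open>L\<^sup>p\<close>. The remainder splits into
  a Bregman divergence, quadratic in the time increment, and the pairing of \<open>dpow p (U t)\<close> with the error of the
  difference quotient, controlled by \<open>young_split\<close>.\<close>

lemma has_derivative_weighted_Lp_energy:
  fixes U :: "real \<Rightarrow> 'a \<Rightarrow> real" and V \<rho> :: "'a \<Rightarrow> real"
  assumes p: "2 \<le> p" and t: "0 \<le> t"
    and U [measurable]: "\<And>s. 0 \<le> s \<Longrightarrow> U s \<in> borel_measurable M"
    and UI: "\<And>s. 0 \<le> s \<Longrightarrow> integrable M (\<lambda>x. \<bar>U s x\<bar> powr p)"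
    and V [measurable]: "V \<in> borel_measurable M" and VI: "integrable M (\<lambda>x. \<bar>V x\<bar> powr p)"
    and \<rho> [measurable]: "\<rho> \<in> borel_measurable M" and \<rho>b: "\<And>x. 0 \<le> \<rho> x" "\<And>x. \<rho> x \<le> c"
    and lim: "((\<lambda>s. \<integral>x. \<bar>(U s x - U t x) / (s - t) - V x\<bar> powr p \<partial>M) \<longlongrightarrow> 0) (at t within {0..})"
  shows "((\<lambda>s. \<integral>x. \<rho> x * \<bar>U s x\<bar> powr p \<partial>M) has_real_derivative
      (\<integral>x. \<rho> x * (p * (dpow p (U t x) * V x)) \<partial>M)) (at t within {0..})"
proof -
  define E where "E s = (\<integral>x. \<rho> x * \<bar>U s x\<bar> powr p \<partial>M)" for s
  define L where "L = (\<integral>x. \<rho> x * (p * (dpow p (U t x) * V x)) \<partial>M)"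
  define J where "J s = (\<integral>x. \<bar>(U s x - U t x) / (s - t) - V x\<bar> powr p \<partial>M)" for s
  define a0 where "a0 = (\<integral>x. \<bar>U t x\<bar> powr p \<partial>M)"
  define v0 where "v0 = (\<integral>x. \<bar>V x\<bar> powr p \<partial>M)"
  define C where "C = p * (p - 1) * 2 powr p"
  \<comment> \<open>The parameter of \<open>young_split\<close> tends to 0 with \<open>J\<close>, slowly enough to keep \<open>J s / \<epsilon> s powr (p - 1) \<le> \<epsilon> s\<close>;
    the term \<open>\<bar>s - t\<bar>\<close> keeps it positive.\<close>
  define \<epsilon> where "\<epsilon> s = (J s + \<bar>s - t\<bar>) powr (1 / p)" for s
  define B where "B s = c * (C * \<bar>s - t\<bar> * (a0 + 2 powr p * (v0 + J s)) + p * (a0 + 1) * \<epsilon> s)" for s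
  have c: "0 \<le> c" using \<rho>b order_trans by blast
  have C: "0 \<le> C" using p by (simp add: C_def)
  have Ut [measurable]: "U t \<in> borel_measurable M" using U[OF t] .
  have \<rho>int: "integrable M (\<lambda>x. \<rho> x * f x)" if "integrable M f" for f :: "'a \<Rightarrow> real"
  proof (rule Bochner_Integration.integrable_bound[of _ "\<lambda>x. c * f x"])
    show "AE x in M. norm (\<rho> x * f x) \<le> norm (c * f x)"
      using \<rho>b c by (intro AE_I2) (auto simp: abs_mult intro!: mult_right_mono)
  qed (use that in auto)
  have main: "\<bar>(E s - E t) / (s - t) - L\<bar> \<le> B s" if s: "0 \<le> s" "s \<noteq> t" "\<bar>s - t\<bar> \<le> 1" for s
  proof -
    define h where "h = s - t"
    have h: "h \<noteq> 0" "\<bar>h\<bar> \<le> 1" using s by (auto simp: h_def)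
    define d where "d x = (U s x - U t x) / h" for x
    have Us [measurable]: "U s \<in> borel_measurable M" using U s by auto
    have [measurable]: "d \<in> borel_measurable M" unfolding d_def by measurable
    have dI: "integrable M (\<lambda>x. \<bar>d x\<bar> powr p)"
    proof -
      have "integrable M (\<lambda>x. \<bar>1 / h\<bar> powr p * \<bar>U s x - U t x\<bar> powr p)"
        using p s t by (intro integrable_mult_right integrable_abs_powr_diff UI) auto
      then show ?thesis by (simp add: d_def powr_mult[symmetric] flip: abs_mult)
    qed
    have dVI: "integrable M (\<lambda>x. \<bar>d x - V x\<bar> powr p)"
      using p dI VI by (intro integrable_abs_powr_diff) auto
    have J: "J s = (\<integral>x. \<bar>d x - V x\<bar> powr p \<partial>M)" by (simp add: J_def d_def h_def)
    have J0: "0 \<le> J s" unfolding J by (rule integral_nonneg_AE) auto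
    have Jh: "0 < J s + \<bar>h\<bar>" using J0 h by linarith
    then have \<epsilon>0: "0 < \<epsilon> s" by (simp add: \<epsilon>_def h_def)
    define X where "X x = \<bar>U s x\<bar> powr p - \<bar>U t x\<bar> powr p - h * (p * (dpow p (U t x) * V x))" for x
    define Y where "Y x = C * h\<^sup>2 * (\<bar>U t x\<bar> powr p + 2 powr p * (\<bar>V x\<bar> powr p + \<bar>d x - V x\<bar> powr p))
        + p * \<bar>h\<bar> * (\<epsilon> s * \<bar>U t x\<bar> powr p + \<epsilon> s powr (1 - p) * \<bar>d x - V x\<bar> powr p)" for x
    have XY: "\<bar>X x\<bar> \<le> Y x" for x
    proof -
      let ?a = "U t x"
      define br where "br = \<bar>?a + h * d x\<bar> powr p - \<bar>?a\<bar> powr p - p * dpow p ?a * (h * d x)"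
      have b: "U s x = ?a + h * d x" using h by (simp add: d_def)
      have "X x = br + p * h * (dpow p ?a * (d x - V x))"
        by (simp add: X_def br_def b algebra_simps)
      moreover have "0 \<le> br"
        using bregman_lower[OF p, of "?a + h * d x" ?a] unfolding br_def by (smt (verit) zero_le_power2)
      moreover have "br \<le> C * h\<^sup>2 * (\<bar>?a\<bar> powr p + \<bar>d x\<bar> powr p)"
        using bregman_upper[OF p h(2), of ?a "d x"] by (simp add: br_def C_def)
      moreover have "\<bar>d x\<bar> powr p \<le> 2 powr p * (\<bar>V x\<bar> powr p + \<bar>d x - V x\<bar> powr p)"
        using p by (intro order_trans[OF powr_mono2 powr_add_le]) auto
      then have "C * h\<^sup>2 * (\<bar>?a\<bar> powr p + \<bar>d x\<bar> powr p)
          \<le> C * h\<^sup>2 * (\<bar>?a\<bar> powr p + 2 powr p * (\<bar>V x\<bar> powr p + \<bar>d x - V x\<bar> powr p))"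
        using C by (intro mult_left_mono add_left_mono) auto
      moreover have "\<bar>p * h * (dpow p ?a * (d x - V x))\<bar>
          \<le> p * \<bar>h\<bar> * (\<epsilon> s * \<bar>?a\<bar> powr p + \<epsilon> s powr (1 - p) * \<bar>d x - V x\<bar> powr p)"
        unfolding abs_mult abs_dpow using p young_split[of p "\<epsilon> s" ?a "d x - V x"] \<epsilon>0
        by (auto intro!: mult_left_mono)
      ultimately show ?thesis unfolding Y_def by linarith
    qed
    have gI: "integrable M (\<lambda>x. p * (dpow p (U t x) * V x))"
      using p t by (intro integrable_mult_right integrable_dpow_mult UI VI) auto
    have XI: "integrable M X" 
      unfolding X_def using UI s t gI by auto
    have YI: "integrable M Y" unfolding Y_def using UI t VI dVI by auto
    have "E s - E t - h * L = (\<integral>x. \<rho> x * X x \<partial>M)"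
    proof -
      have 1: "E s - E t = (\<integral>x. \<rho> x * \<bar>U s x\<bar> powr p - \<rho> x * \<bar>U t x\<bar> powr p \<partial>M)"
        unfolding E_def using \<rho>int[OF UI] s t by simp
      have "E s - E t - h * L = (\<integral>x. (\<rho> x * \<bar>U s x\<bar> powr p - \<rho> x * \<bar>U t x\<bar> powr p)
           - h * (\<rho> x * (p * (dpow p (U t x) * V x))) \<partial>M)"
        unfolding 1 L_def using \<rho>int[OF UI] s t \<rho>int[OF gI] by simp
      then show ?thesis by (simp add: X_def algebra_simps)
    qed
    also have "\<bar>\<dots>\<bar> \<le> (\<integral>x. c * Y x \<partial>M)"
    proof -
      have "\<bar>\<integral>x. \<rho> x * X x \<partial>M\<bar> \<le> (\<integral>x. \<bar>\<rho> x * X x\<bar> \<partial>M)"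
        by (rule integral_abs_bound)
      also have "\<dots> \<le> (\<integral>x. c * Y x \<partial>M)"
        using \<rho>int[OF integrable_abs[OF XI]] YI \<rho>b XY c unfolding abs_mult
        by (intro integral_mono) (auto simp: abs_mult intro!: mult_mono)
      finally show ?thesis .
    qed
    also have "\<dots> = c * (C * h\<^sup>2 * (a0 + 2 powr p * (v0 + J s)) 
        + p * \<bar>h\<bar> * (\<epsilon> s * a0 + \<epsilon> s powr (1 - p) * J s))"
      unfolding Y_def a0_def v0_def J using UI t VI dVI by simp
    also have "\<dots> \<le> c * (C * h\<^sup>2 * (a0 + 2 powr p * (v0 + J s)) + p * \<bar>h\<bar> * (\<epsilon> s * a0 + \<epsilon> s))"
    proof -
      have "\<epsilon> s powr (1 - p) * J s \<le> \<epsilon> s powr (1 - p) * (J s + \<bar>h\<bar>)"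
        by (intro mult_left_mono) auto
      also have "J s + \<bar>h\<bar> = \<epsilon> s powr p" using Jh p by (simp add: \<epsilon>_def h_def powr_powr)
      also have "\<epsilon> s powr (1 - p) * \<epsilon> s powr p = \<epsilon> s" using \<epsilon>0 by (simp flip: powr_add)
      finally show ?thesis using c p by (intro mult_left_mono add_left_mono) auto
    qed
    also have "\<dots> = \<bar>h\<bar> * B s" 
    proof -
      have "c * (C * (q * q) * Z + p * q * (\<epsilon> s * a0 + \<epsilon> s)) = q * (c * (C * q * Z + p * (a0 + 1) * \<epsilon> s))"
        for q Z by (simp add: algebra_simps)
      moreover have "h\<^sup>2 = \<bar>h\<bar> * \<bar>h\<bar>" by (simp add: power2_eq_square)
      ultimately show ?thesis unfolding B_def h_def[symmetric] by (simp only:)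
    qed
    finally have "\<bar>E s - E t - h * L\<bar> \<le> \<bar>h\<bar> * B s" .
    moreover have "(E s - E t) / (s - t) - L = (E s - E t - h * L) / h"
      using h by (simp add: h_def field_simps)
    ultimately show ?thesis using h by (simp add: abs_divide divide_le_eq mult.commute)
  qed
  have limJ: "(J \<longlongrightarrow> 0) (at t within {0..})" using lim unfolding J_def[abs_def] .
  have lim_id: "((\<lambda>s. \<bar>s - t\<bar>) \<longlongrightarrow> 0) (at t within {0..})"
    by (auto intro!: tendsto_eq_intros)
  have "((\<lambda>s. J s + \<bar>s - t\<bar>) \<longlongrightarrow> 0) (at t within {0..})"
    using tendsto_add[OF limJ lim_id] by simp
  then have "(\<epsilon> \<longlongrightarrow> 0 powr (1 / p)) (at t within {0..})"
    unfolding \<epsilon>_def[abs_def] using p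
    by (intro tendsto_powr2 tendsto_const) 
       (auto simp: J_def intro!: always_eventually add_nonneg_nonneg integral_nonneg_AE)
  then have lim\<epsilon>: "(\<epsilon> \<longlongrightarrow> 0) (at t within {0..})" using p by simp
  have "(B \<longlongrightarrow> c * (C * 0 * (a0 + 2 powr p * (v0 + 0)) + p * (a0 + 1) * 0)) (at t within {0..})"
    unfolding B_def[abs_def] by (intro tendsto_intros limJ lim_id lim\<epsilon>)
  then have limB: "(B \<longlongrightarrow> 0) (at t within {0..})" by simp
  have "eventually (\<lambda>s. norm ((E s - E t) / (s - t) - L) \<le> B s) (at t within {0..})"
    unfolding eventually_at by (rule exI[of _ 1]) (auto simp: dist_real_def intro!: main)
  then have "((\<lambda>s. (E s - E t) / (s - t) - L) \<longlongrightarrow> 0) (at t within {0..})"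
    using limB by (rule Lim_null_comparison)
  then have "((\<lambda>s. (E s - E t) / (s - t)) \<longlongrightarrow> L) (at t within {0..})"
    by (rule LIM_zero_cancel)
  then show ?thesis unfolding E_def L_def has_field_derivative_iff .
qed

text \<open>The \<open>L\<^sup>1\<close> norm need not be differentiable along the curve. It suffices that a forward Euler step does not
  increase it and a backward Euler step does not decrease it: up to any slope \<open>e > 0\<close> the norm is then nonincreasing
  near each time, and bisection makes this global.\<close>

lemma L1_norm_nonincreasing:
  fixes U V :: "real \<Rightarrow> 'a \<Rightarrow> real"
  assumes U: "\<And>t. 0 \<le> t \<Longrightarrow> integrable M (U t)" and V: "\<And>t. 0 \<le> t \<Longrightarrow> integrable M (V t)"
    and lim: "\<And>t. 0 \<le> t \<Longrightarrow> 
      ((\<lambda>s. \<integral>x. \<bar>(U s x - U t x) / (s - t) - V t x\<bar> \<partial>M) \<longlongrightarrow> 0) (at t within {0..})"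
    and \<eta>: "0 < \<eta>"
    and fwd: "\<And>t h. 0 \<le> t \<Longrightarrow> 0 \<le> h \<Longrightarrow> h \<le> \<eta> \<Longrightarrow> 
      (\<integral>x. \<bar>U t x + h * V t x\<bar> \<partial>M) \<le> (\<integral>x. \<bar>U t x\<bar> \<partial>M)"
    and bwd: "\<And>t h. 0 \<le> t \<Longrightarrow> 0 \<le> h \<Longrightarrow> 
      (\<integral>x. \<bar>U t x\<bar> \<partial>M) \<le> (\<integral>x. \<bar>U t x - h * V t x\<bar> \<partial>M)"
    and t: "0 \<le> t"
  shows "(\<integral>x. \<bar>U t x\<bar> \<partial>M) \<le> (\<integral>x. \<bar>U 0 x\<bar> \<partial>M)"
proof -
  define f where "f t = (\<integral>x. \<bar>U t x\<bar> \<partial>M)" for t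
  have "f t \<le> f 0 + e * (t - 0)" if e: "0 < e" for e
  proof -
    define Q where "Q a b \<longleftrightarrow> (0 \<le> a \<longrightarrow> f b \<le> f a + e * (b - a))" for a b :: real
    have "Q 0 t"
    proof (rule Bolzano[OF t, of Q])
      show "Q a c" if "Q a b" "Q b c" "a \<le> b" "b \<le> c" for a b c
        using that by (auto simp: Q_def algebra_simps)
    next
      fix x :: real assume x: "0 \<le> x"
      define J where "J s = (\<integral>y. \<bar>(U s y - U x y) / (s - x) - V x y\<bar> \<partial>M)" for s
      have "eventually (\<lambda>s. J s < e) (at x within {0..})"
        using lim[OF x] e unfolding J_def by (rule order_tendstoD)
      then obtain d where d: "0 < d" "\<And>s. 0 \<le> s \<Longrightarrow> s \<noteq> x \<Longrightarrow> \<bar>s - x\<bar> < d \<Longrightarrow> J s < e"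
        unfolding eventually_at by (auto simp: dist_real_def)
      have near: "\<bar>f s - (\<integral>y. \<bar>U x y + (s - x) * V x y\<bar> \<partial>M)\<bar> \<le> e * \<bar>s - x\<bar>"
        if s: "0 \<le> s" "\<bar>s - x\<bar> < d" for s
      proof (cases "s = x")
        case True then show ?thesis by (simp add: f_def)
      next
        case False
        have I: "integrable M (U s)" "integrable M (U x)" "integrable M (V x)" using U V s x by auto
        have "f s - (\<integral>y. \<bar>U x y + (s - x) * V x y\<bar> \<partial>M) 
            = (\<integral>y. \<bar>U s y\<bar> - \<bar>U x y + (s - x) * V x y\<bar> \<partial>M)"
          unfolding f_def using I by simp
        also have "\<bar>\<dots>\<bar> \<le> (\<integral>y. \<bar>\<bar>U s y\<bar> - \<bar>U x y + (s - x) * V x y\<bar>\<bar> \<partial>M)"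
          by (rule integral_abs_bound)
        also have "\<dots> \<le> (\<integral>y. \<bar>s - x\<bar> * \<bar>(U s y - U x y) / (s - x) - V x y\<bar> \<partial>M)"
        proof (rule integral_mono)
          fix y
          have "(s - x) * ((U s y - U x y) / (s - x) - V x y) = U s y - (U x y + (s - x) * V x y)"
            using False by (subst right_diff_distrib) simp
          then have "\<bar>s - x\<bar> * \<bar>(U s y - U x y) / (s - x) - V x y\<bar> = \<bar>U s y - (U x y + (s - x) * V x y)\<bar>"
            by (subst abs_mult[symmetric]) (rule arg_cong[where f = abs])
          then show "\<bar>\<bar>U s y\<bar> - \<bar>U x y + (s - x) * V x y\<bar>\<bar> 
              \<le> \<bar>s - x\<bar> * \<bar>(U s y - U x y) / (s - x) - V x y\<bar>" by simp
        qed (use I in auto)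
        also have "\<dots> = \<bar>s - x\<bar> * J s" by (simp add: J_def)
        also have "\<dots> \<le> e * \<bar>s - x\<bar>" 
          using mult_left_mono[OF less_imp_le[OF d(2)[OF s(1) False s(2)]], of "\<bar>s - x\<bar>"]
          by (simp add: mult.commute)
        finally show ?thesis .
      qed
      show "\<exists>d>0. \<forall>a b. a \<le> x \<and> x \<le> b \<and> b - a < d \<longrightarrow> Q a b"
      proof (intro exI[of _ "min d \<eta>"] conjI allI impI)
        fix a b assume ab: "a \<le> x \<and> x \<le> b \<and> b - a < min d \<eta>"
        show "Q a b" unfolding Q_def
        proof
          assume a: "0 \<le> a"
          have "f b \<le> f x + e * (b - x)"
            using near[of b] fwd[OF x, of "b - x"] ab x unfolding f_def by auto
          moreover have "f x \<le> f a + e * (x - a)"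
          proof -
            have "(\<integral>y. \<bar>U x y - (x - a) * V x y\<bar> \<partial>M) = (\<integral>y. \<bar>U x y + (a - x) * V x y\<bar> \<partial>M)"
              by (intro Bochner_Integration.integral_cong refl) (simp add: algebra_simps)
            then show ?thesis
              using near[of a] bwd[OF x, of "x - a"] ab a unfolding f_def by auto
          qed
          ultimately show "f b \<le> f a + e * (b - a)" by (simp add: algebra_simps)
        qed
      qed (use d \<eta> in auto)
    qed
    then show ?thesis by (simp add: Q_def)
  qed
  then have *: "f t \<le> f 0 + e * t" if "0 < e" for e using that by simp
  have "f t \<le> f 0"
  proof (rule field_le_epsilon)
    fix e :: real assume e: "0 < e"
    have "e / (t + 1) * t \<le> e" using e t by (simp add: field_simps)
    then show "f t \<le> f 0 + e" using *[of "e / (t + 1)"] e t by simp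
  qed
  then show ?thesis by (simp add: f_def)
qed

section \<open>Dissipation for a balanced kernel\<close>

text \<open>The setting after passing to Borel versions: \<open>S\<close> is the column integral of the kernel \<open>k\<close>, and \<open>e\<close> is an
  equilibrium with values in \<open>[1/m, m]\<close>. The row and column assumptions together say that \<open>k x y * e y\<close> has equal
  row and column integrals.\<close>

locale balanced_kernel =
  fixes k :: "'a::euclidean_space \<Rightarrow> 'a \<Rightarrow> real" and S e :: "'a \<Rightarrow> real" and m CK r R :: real
  assumes k_meas [measurable]: "(\<lambda>(x, y). k x y) \<in> borel_measurable (borel \<Otimes>\<^sub>M borel)"
    and k_nonneg: "\<And>x y. 0 \<le> k x y"
    and k_band: "\<And>x y. norm (x - y) < R \<Longrightarrow> r \<le> k x y"
    and r: "0 < r" and R: "0 < R" and CK: "0 < CK" and m: "0 < m"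
    and S_meas [measurable]: "S \<in> borel_measurable borel"
    and S_nonneg: "\<And>x. 0 \<le> S x" and S_le: "\<And>x. S x \<le> CK"
    and e_meas [measurable]: "e \<in> borel_measurable borel"
    and e_ge: "\<And>x. 1 / m \<le> e x" and e_le: "\<And>x. e x \<le> m"
    and col: "AE y in lborel. (\<integral>\<^sup>+x. ennreal (k x y) \<partial>lborel) = ennreal (S y)"
    and row: "AE x in lborel. (\<integral>\<^sup>+y. ennreal (k x y * e y) \<partial>lborel) = ennreal (S x * e x)"
begin

lemma e_pos: "0 < e x"
  using e_ge[of x] m by (smt (verit) divide_pos_pos)

lemma integrable_S:
  assumes "integrable lborel f"
  shows "integrable lborel (\<lambda>x. S x * f x)"
proof (rule Bochner_Integration.integrable_bound)
  show "integrable lborel (\<lambda>x. CK * f x)" using assms by simp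
  show "AE x in lborel. norm (S x * f x) \<le> norm (CK * f x)"
    using S_nonneg S_le CK by (intro AE_I2) (auto simp: abs_mult intro!: mult_right_mono)
qed (use borel_measurable_integrable[OF assms] in measurable)

lemma integrable_e:
  assumes "integrable lborel f"
  shows "integrable lborel (\<lambda>x. e x * f x)"
proof (rule Bochner_Integration.integrable_bound)
  show "integrable lborel (\<lambda>x. m * f x)" using assms by simp
  show "AE x in lborel. norm (e x * f x) \<le> norm (m * f x)"
    using e_le m by (intro AE_I2) (auto simp: abs_mult abs_of_pos[OF e_pos] intro!: mult_right_mono)
qed (use borel_measurable_integrable[OF assms] in measurable)

lemma column_integral:
  assumes f: "integrable lborel f" and f0: "\<And>x. 0 \<le> f x"
  shows "integrable (lborel \<Otimes>\<^sub>M lborel) (\<lambda>(x, y). k x y * f y)" (is "integrable _ ?g")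
    and "(\<integral>z. (case z of (x, y) \<Rightarrow> k x y * f y) \<partial>(lborel \<Otimes>\<^sub>M lborel)) = (\<integral>x. S x * f x \<partial>lborel)"
proof -
  have [measurable]: "f \<in> borel_measurable borel" using borel_measurable_integrable[OF f] by simp
  have I: "integrable lborel (\<lambda>x. S x * f x)" using integrable_S[OF f] .
  have nn: "(\<integral>\<^sup>+z. ennreal (?g z) \<partial>(lborel \<Otimes>\<^sub>M lborel)) = ennreal (\<integral>x. S x * f x \<partial>lborel)"
  proof -
    have "(\<integral>\<^sup>+z. ennreal (?g z) \<partial>(lborel \<Otimes>\<^sub>M lborel)) = (\<integral>\<^sup>+y. (\<integral>\<^sup>+x. ennreal (?g (x, y)) \<partial>lborel) \<partial>lborel)"
      by (rule lborel_pair.nn_integral_snd[symmetric]) measurable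
    also have "\<dots> = (\<integral>\<^sup>+y. ennreal (S y * f y) \<partial>lborel)"
    proof (rule nn_integral_cong_AE)
      show "AE y in lborel. (\<integral>\<^sup>+x. ennreal (?g (x, y)) \<partial>lborel) = ennreal (S y * f y)"
        using col
      proof eventually_elim
        case (elim y)
        have "(\<integral>\<^sup>+x. ennreal (?g (x, y)) \<partial>lborel) = (\<integral>\<^sup>+x. ennreal (k x y) * ennreal (f y) \<partial>lborel)"
          using f0 k_nonneg by (simp add: ennreal_mult)
        also have "\<dots> = ennreal (S y) * ennreal (f y)"
          by (subst nn_integral_multc) (auto simp: elim)
        finally show ?case using S_nonneg f0 by (simp add: ennreal_mult)
      qed
    qed
    also have "\<dots> = ennreal (\<integral>x. S x * f x \<partial>lborel)"
      using I S_nonneg f0 by (intro nn_integral_eq_integral) auto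
    finally show ?thesis .
  qed
  have nonneg: "0 \<le> ?g z" for z using k_nonneg f0 by (cases z) auto
  show "integrable (lborel \<Otimes>\<^sub>M lborel) ?g"
    using nn nonneg by (intro integrableI_nonneg) auto
  show "(\<integral>z. ?g z \<partial>(lborel \<Otimes>\<^sub>M lborel)) = (\<integral>x. S x * f x \<partial>lborel)"
    using nn nonneg S_nonneg f0
    by (subst integral_eq_nn_integral) (auto intro!: enn2real_ennreal integral_nonneg_AE)
qed

lemma row_integral:
  assumes f: "integrable lborel f" and f0: "\<And>x. 0 \<le> f x"
  shows "integrable (lborel \<Otimes>\<^sub>M lborel) (\<lambda>(x, y). k x y * e y * f x)" (is "integrable _ ?g")
    and "(\<integral>z. (case z of (x, y) \<Rightarrow> k x y * e y * f x) \<partial>(lborel \<Otimes>\<^sub>M lborel)) = (\<integral>x. S x * (e x * f x) \<partial>lborel)"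
proof -
  have [measurable]: "f \<in> borel_measurable borel" using borel_measurable_integrable[OF f] by simp
  have I: "integrable lborel (\<lambda>x. S x * (e x * f x))" using integrable_S[OF integrable_e[OF f]] .
  have e0: "0 \<le> e x" for x using e_pos[of x] by simp
  have nn: "(\<integral>\<^sup>+z. ennreal (?g z) \<partial>(lborel \<Otimes>\<^sub>M lborel)) = ennreal (\<integral>x. S x * (e x * f x) \<partial>lborel)"
  proof -
    have "(\<integral>\<^sup>+z. ennreal (?g z) \<partial>(lborel \<Otimes>\<^sub>M lborel)) = (\<integral>\<^sup>+x. (\<integral>\<^sup>+y. ennreal (?g (x, y)) \<partial>lborel) \<partial>lborel)"
      by (rule lborel.nn_integral_fst[symmetric]) measurable
    also have "\<dots> = (\<integral>\<^sup>+x. ennreal (S x * (e x * f x)) \<partial>lborel)"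
    proof (rule nn_integral_cong_AE)
      show "AE x in lborel. (\<integral>\<^sup>+y. ennreal (?g (x, y)) \<partial>lborel) = ennreal (S x * (e x * f x))"
        using row
      proof eventually_elim
        case (elim x)
        have "(\<integral>\<^sup>+y. ennreal (?g (x, y)) \<partial>lborel) = (\<integral>\<^sup>+y. ennreal (k x y * e y) * ennreal (f x) \<partial>lborel)"
          using f0 k_nonneg e0 by (simp add: ennreal_mult)
        also have "\<dots> = ennreal (S x * e x) * ennreal (f x)"
          by (subst nn_integral_multc) (auto simp: elim)
        finally show ?case using S_nonneg f0 e0 by (simp add: ennreal_mult mult.assoc)
      qed
    qed
    also have "\<dots> = ennreal (\<integral>x. S x * (e x * f x) \<partial>lborel)"
      using I S_nonneg f0 e0 by (intro nn_integral_eq_integral) auto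
    finally show ?thesis .
  qed
  have nonneg: "0 \<le> ?g z" for z using k_nonneg f0 e0 by (cases z) auto
  show "integrable (lborel \<Otimes>\<^sub>M lborel) ?g"
    using nn nonneg by (intro integrableI_nonneg) auto
  show "(\<integral>z. ?g z \<partial>(lborel \<Otimes>\<^sub>M lborel)) = (\<integral>x. S x * (e x * f x) \<partial>lborel)"
    using nn nonneg S_nonneg f0 e0
    by (subst integral_eq_nn_integral) (auto intro!: enn2real_ennreal integral_nonneg_AE)
qed

text \<open>Euler steps of the equation \<open>V = k U - S U\<close> in \<open>L\<^sup>1\<close>: the gain term has the same total integral as the loss
  term. The smallness of \<open>h\<close> keeps \<open>1 - h * S x\<close> nonnegative in the forward step.\<close>

lemma L1_step:
  assumes U: "integrable lborel U" and V: "integrable lborel V"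
    and eq: "AE x in lborel. integrable lborel (\<lambda>y. k x y * U y) \<and> 
       V x = (\<integral>y. k x y * U y \<partial>lborel) - S x * U x"
    and h: "0 \<le> h"
  shows "h * CK \<le> 1 \<Longrightarrow> (\<integral>x. \<bar>U x + h * V x\<bar> \<partial>lborel) \<le> (\<integral>x. \<bar>U x\<bar> \<partial>lborel)"
    and "(\<integral>x. \<bar>U x\<bar> \<partial>lborel) \<le> (\<integral>x. \<bar>U x - h * V x\<bar> \<partial>lborel)"
proof -
  define I where "I x = (\<integral>y. k x y * \<bar>U y\<bar> \<partial>lborel)" for x
  note ci = column_integral[of "\<lambda>x. \<bar>U x\<bar>", OF integrable_abs[OF U], simplified]
  have II: "integrable lborel I" 
    unfolding I_def using lborel_pair.integrable_fst'[OF ci(1)] by simp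
  have Iint: "(\<integral>x. I x \<partial>lborel) = (\<integral>x. S x * \<bar>U x\<bar> \<partial>lborel)"
    unfolding I_def using lborel_pair.integral_fst'[OF ci(1)] ci(2) by simp
  have SU: "integrable lborel (\<lambda>x. S x * \<bar>U x\<bar>)" using integrable_S[OF integrable_abs[OF U]] .
  have bound: "AE x in lborel. \<bar>V x + S x * U x\<bar> \<le> I x"
    using eq
  proof eventually_elim
    case (elim x)
    then have "\<bar>V x + S x * U x\<bar> = \<bar>\<integral>y. k x y * U y \<partial>lborel\<bar>" by simp
    also have "\<dots> \<le> (\<integral>y. \<bar>k x y * U y\<bar> \<partial>lborel)" by (rule integral_abs_bound)
    also have "\<dots> = I x" unfolding I_def using k_nonneg by (simp add: abs_mult)
    finally show ?case .
  qed
  {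
    assume hC: "h * CK \<le> 1"
    have "(\<integral>x. \<bar>U x + h * V x\<bar> \<partial>lborel) \<le> (\<integral>x. \<bar>U x\<bar> - h * (S x * \<bar>U x\<bar>) + h * I x \<partial>lborel)"
    proof (rule integral_mono_AE)
      show "AE x in lborel. \<bar>U x + h * V x\<bar> \<le> \<bar>U x\<bar> - h * (S x * \<bar>U x\<bar>) + h * I x"
        using bound
      proof eventually_elim
        case (elim x)
        have "h * S x \<le> h * CK" using h S_le by (intro mult_left_mono) auto
        then have hS: "0 \<le> 1 - h * S x" using hC by simp
        have "\<bar>U x + h * V x\<bar> = \<bar>(1 - h * S x) * U x + h * (V x + S x * U x)\<bar>"
          by (simp add: algebra_simps)
        also have "\<dots> \<le> \<bar>(1 - h * S x) * U x\<bar> + \<bar>h * (V x + S x * U x)\<bar>" by (rule abs_triangle_ineq)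
        also have "\<dots> = (1 - h * S x) * \<bar>U x\<bar> + h * \<bar>V x + S x * U x\<bar>"
          using hS h by (simp add: abs_mult)
        also have "\<dots> \<le> (1 - h * S x) * \<bar>U x\<bar> + h * I x"
          using elim h by (intro add_left_mono mult_left_mono) auto
        finally show ?case by (simp add: algebra_simps)
      qed
    qed (use U V SU II in auto)
    also have "\<dots> = (\<integral>x. \<bar>U x\<bar> \<partial>lborel)" using U SU II by (simp add: Iint)
    finally show "(\<integral>x. \<bar>U x + h * V x\<bar> \<partial>lborel) \<le> (\<integral>x. \<bar>U x\<bar> \<partial>lborel)" .
  }
  have "(\<integral>x. \<bar>U x\<bar> \<partial>lborel) = (\<integral>x. \<bar>U x\<bar> + h * (S x * \<bar>U x\<bar>) - h * I x \<partial>lborel)" 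
    using U SU II by (simp add: Iint)
  also have "\<dots> \<le> (\<integral>x. \<bar>U x - h * V x\<bar> \<partial>lborel)"
  proof (rule integral_mono_AE)
    show "AE x in lborel. \<bar>U x\<bar> + h * (S x * \<bar>U x\<bar>) - h * I x \<le> \<bar>U x - h * V x\<bar>"
      using bound
    proof eventually_elim
      case (elim x)
      have "\<bar>U x\<bar> + h * (S x * \<bar>U x\<bar>) - h * I x \<le> \<bar>U x\<bar> + h * (S x * \<bar>U x\<bar>) - h * \<bar>V x + S x * U x\<bar>"
        using elim h by (intro diff_left_mono mult_left_mono) auto
      also have "\<dots> = \<bar>(1 + h * S x) * U x\<bar> - \<bar>h * (V x + S x * U x)\<bar>"
      proof -
        have "\<bar>(1 + h * S x) * U x\<bar> = (1 + h * S x) * \<bar>U x\<bar>"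
          using h S_nonneg[of x] by (simp add: abs_mult)
        moreover have "\<bar>h * (V x + S x * U x)\<bar> = h * \<bar>V x + S x * U x\<bar>"
          using h by (simp only: abs_mult abs_of_nonneg)
        ultimately show ?thesis by (simp only: distrib_right mult_1_left mult.assoc)
      qed
      also have "\<dots> \<le> \<bar>(1 + h * S x) * U x - h * (V x + S x * U x)\<bar>" by (rule abs_triangle_ineq2)
      also have "(1 + h * S x) * U x - h * (V x + S x * U x) = U x - h * V x" by (simp add: algebra_simps)
      finally show ?case .
    qed
  qed (use U V SU II in auto)
  finally show "(\<integral>x. \<bar>U x\<bar> \<partial>lborel) \<le> (\<integral>x. \<bar>U x - h * V x\<bar> \<partial>lborel)" .
qed

text \<open>The quadratic form of the balanced kernel \<open>k x y * e y\<close>.\<close>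

definition dissipation :: "('a \<Rightarrow> real) \<Rightarrow> real" where
  "dissipation W = (\<integral>z. (case z of (x, y) \<Rightarrow> k x y * e y * (W y - W x)\<^sup>2) \<partial>(lborel \<Otimes>\<^sub>M lborel))"

lemma integrable_dissipation:
  assumes [measurable]: "W \<in> borel_measurable borel" and W2: "integrable lborel (\<lambda>x. (W x)\<^sup>2)"
  shows "integrable (lborel \<Otimes>\<^sub>M lborel) (\<lambda>(x, y). k x y * e y * (W y - W x)\<^sup>2)"
proof (rule Bochner_Integration.integrable_bound)
  have e0: "0 \<le> e x" for x using e_pos[of x] by simp
  show "integrable (lborel \<Otimes>\<^sub>M lborel) (\<lambda>z. 2 * (case z of (x, y) \<Rightarrow> k x y * (e y * (W y)\<^sup>2))
      + 2 * (case z of (x, y) \<Rightarrow> k x y * e y * (W x)\<^sup>2))"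
    using column_integral(1)[OF integrable_e[OF W2]] row_integral(1)[OF W2] e0 by auto
  have "k x y * e y * (W y - W x)\<^sup>2 \<le> 2 * (k x y * (e y * (W y)\<^sup>2)) + 2 * (k x y * e y * (W x)\<^sup>2)" for x y
  proof -
    have "(W y - W x)\<^sup>2 \<le> 2 * (W y)\<^sup>2 + 2 * (W x)\<^sup>2"
      using sum_squares_bound[of "W y" "- W x"] by (simp add: power2_diff)
    then have "k x y * e y * (W y - W x)\<^sup>2 \<le> k x y * e y * (2 * (W y)\<^sup>2 + 2 * (W x)\<^sup>2)"
      using k_nonneg e0 by (intro mult_left_mono) auto
    then show ?thesis by (simp add: algebra_simps)
  qed
  then show "AE z in lborel \<Otimes>\<^sub>M lborel. norm (case z of (x, y) \<Rightarrow> k x y * e y * (W y - W x)\<^sup>2)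
     \<le> norm (2 * (case z of (x, y) \<Rightarrow> k x y * (e y * (W y)\<^sup>2))
      + 2 * (case z of (x, y) \<Rightarrow> k x y * e y * (W x)\<^sup>2))"
    using k_nonneg e0 by (intro AE_I2) (auto simp: split_beta)
qed measurable

lemma dissipation_nonneg: "0 \<le> dissipation W"
proof -
  have e0: "0 \<le> e x" for x using e_pos[of x] by simp
  show ?thesis unfolding dissipation_def using k_nonneg e0 by (intro integral_nonneg_AE) auto
qed

lemma nonlocal_energy_le_dissipation:
  assumes [measurable]: "W \<in> borel_measurable borel" and W2: "integrable lborel (\<lambda>x. (W x)\<^sup>2)"
  shows "nonlocal_energy R W \<le> ennreal (m / r * dissipation W)"
proof -
  have e0: "0 \<le> e x" for x using e_pos[of x] by simp
  let ?f = "\<lambda>x z. indicator (ball 0 R) z * ennreal ((W (x + z) - W x)\<^sup>2)"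
  have "nonlocal_energy R W = (\<integral>\<^sup>+z. (\<integral>\<^sup>+x. ?f x z \<partial>lborel) \<partial>lborel)"
    unfolding nonlocal_energy_def shift_energy_def by (simp add: nn_integral_cmult)
  also have "\<dots> = (\<integral>\<^sup>+x. (\<integral>\<^sup>+z. ?f x z \<partial>lborel) \<partial>lborel)"
    by (rule lborel_pair.Fubini') measurable
  also have "\<dots> = (\<integral>\<^sup>+x. (\<integral>\<^sup>+y. ?f x (- x + y) \<partial>lborel) \<partial>lborel)"
    by (subst nn_integral_lborel_translate) auto
  also have "\<dots> \<le> (\<integral>\<^sup>+x. (\<integral>\<^sup>+y. ennreal (m / r * (k x y * e y * (W y - W x)\<^sup>2)) \<partial>lborel) \<partial>lborel)"
  proof (intro nn_integral_mono)
    fix x y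
    have "(W y - W x)\<^sup>2 \<le> m / r * (k x y * e y * (W y - W x)\<^sup>2)" if "norm (x - y) < R"
    proof -
      have "r * (1 / m) \<le> k x y * e y" 
        using k_band[OF that] e_ge[of y] r m k_nonneg by (intro mult_mono) auto
      then have "m / r * (r * (1 / m)) \<le> m / r * (k x y * e y)"
        using r m by (intro mult_left_mono) auto
      then have "1 \<le> m / r * (k x y * e y)" using r m by simp
      then have "1 * (W y - W x)\<^sup>2 \<le> m / r * (k x y * e y) * (W y - W x)\<^sup>2"
        by (intro mult_right_mono) auto
      then show ?thesis by (simp add: mult.assoc)
    qed
    then show "?f x (- x + y) \<le> ennreal (m / r * (k x y * e y * (W y - W x)\<^sup>2))"
      by (auto simp: indicator_def dist_norm norm_minus_commute intro!: ennreal_leI)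
  qed
  also have "\<dots> = (\<integral>\<^sup>+z. ennreal (m / r * (case z of (x, y) \<Rightarrow> k x y * e y * (W y - W x)\<^sup>2)) \<partial>(lborel \<Otimes>\<^sub>M lborel))"
    by (subst lborel.nn_integral_fst[symmetric]) simp_all
  also have "\<dots> = ennreal (m / r * dissipation W)"
    unfolding dissipation_def
    using integrable_dissipation[OF assms] k_nonneg e0 m r
    by (subst nn_integral_eq_integral) auto
  finally show ?thesis .
qed

text \<open>Integrate \<open>bregman_lower\<close> for \<open>a = U x / e x\<close> and \<open>b = U y / e y\<close> against \<open>k x y * e y\<close>. The balance of rows and
  columns cancels the two integrals of the \<open>p\<close>-th powers.\<close>

lemma entropy_dissipation:
  assumes p: "2 \<le> p"
    and [measurable]: "U \<in> borel_measurable borel" "V \<in> borel_measurable borel"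
    and UI: "integrable lborel (\<lambda>x. \<bar>U x\<bar> powr p)" and VI: "integrable lborel (\<lambda>x. \<bar>V x\<bar> powr p)"
    and eq: "AE x in lborel. integrable lborel (\<lambda>y. k x y * U y) \<and> 
       V x = (\<integral>y. k x y * U y \<partial>lborel) - S x * U x"
  shows "(\<integral>x. p * (dpow p (U x / e x) * V x) \<partial>lborel) \<le> - dissipation (\<lambda>x. \<bar>U x / e x\<bar> powr (p/2))"
proof -
  have e0: "0 \<le> e x" for x using e_pos[of x] by simp
  define w where "w x = U x / e x" for x
  have U_w: "U x = e x * w x" for x using e_pos[of x] by (simp add: w_def)
  have [measurable]: "w \<in> borel_measurable borel" unfolding w_def by measurable
  let ?W = "\<lambda>x. \<bar>w x\<bar> powr (p/2)"
  have W2: "(?W x)\<^sup>2 = \<bar>w x\<bar> powr p" for x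
    by (simp add: power2_eq_square flip: powr_add)
  have wI: "integrable lborel (\<lambda>x. \<bar>w x\<bar> powr p)"
  proof (rule Bochner_Integration.integrable_bound)
    show "integrable lborel (\<lambda>x. m powr p * \<bar>U x\<bar> powr p)" using UI by simp
    have "\<bar>w x\<bar> powr p \<le> m powr p * \<bar>U x\<bar> powr p" for x
    proof -
      have "1 / e x \<le> m" using e_ge[of x] e_pos[of x] m by (simp add: field_simps)
      then have "\<bar>w x\<bar> \<le> m * \<bar>U x\<bar>" 
        using e_pos[of x] mult_right_mono[of "1 / e x" m "\<bar>U x\<bar>"] by (simp add: w_def)
      then have "\<bar>w x\<bar> powr p \<le> (m * \<bar>U x\<bar>) powr p" using p by (intro powr_mono2) auto
      then show ?thesis by (simp only: powr_mult)
    qed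
    then show "AE x in lborel. norm (\<bar>w x\<bar> powr p) \<le> norm (m powr p * \<bar>U x\<bar> powr p)" by simp
  qed measurable
  define g1 where "g1 = (\<lambda>(x, y). k x y * (e y * \<bar>w y\<bar> powr p))"
  define g2 where "g2 = (\<lambda>(x, y). k x y * e y * \<bar>w x\<bar> powr p)"
  define g3 where "g3 = (\<lambda>(x, y). k x y * e y * (?W y - ?W x)\<^sup>2)"
  have g1: "integrable (lborel \<Otimes>\<^sub>M lborel) g1"
      "integral\<^sup>L (lborel \<Otimes>\<^sub>M lborel) g1 = (\<integral>x. S x * (e x * \<bar>w x\<bar> powr p) \<partial>lborel)"
    using column_integral[OF integrable_e[OF wI]] e0 by (auto simp: g1_def)
  have g2: "integrable (lborel \<Otimes>\<^sub>M lborel) g2"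
      "integral\<^sup>L (lborel \<Otimes>\<^sub>M lborel) g2 = (\<integral>x. S x * (e x * \<bar>w x\<bar> powr p) \<partial>lborel)"
    using row_integral[OF wI] by (auto simp: g2_def)
  have g3: "integrable (lborel \<Otimes>\<^sub>M lborel) g3"
    unfolding g3_def by (rule integrable_dissipation) (simp_all only: W2 wI, measurable)
  have "(\<integral>x. p * (dpow p (w x) * V x) \<partial>lborel)
      \<le> (\<integral>x. (\<integral>y. g1 (x, y) \<partial>lborel) - (\<integral>y. g2 (x, y) \<partial>lborel) - (\<integral>y. g3 (x, y) \<partial>lborel) \<partial>lborel)"
  proof (rule integral_mono_AE)
    show "integrable lborel (\<lambda>x. p * (dpow p (w x) * V x))"
      using p by (intro integrable_mult_right integrable_dpow_mult wI VI) auto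
    show "integrable lborel (\<lambda>x. (\<integral>y. g1 (x, y) \<partial>lborel) - (\<integral>y. g2 (x, y) \<partial>lborel) - (\<integral>y. g3 (x, y) \<partial>lborel))"
      by (intro Bochner_Integration.integrable_diff lborel_pair.integrable_fst' g1 g2 g3)
    show "AE x in lborel. p * (dpow p (w x) * V x)
       \<le> (\<integral>y. g1 (x, y) \<partial>lborel) - (\<integral>y. g2 (x, y) \<partial>lborel) - (\<integral>y. g3 (x, y) \<partial>lborel)"
      using eq row lborel_pair.AE_integrable_fst'[OF g1(1)] lborel_pair.AE_integrable_fst'[OF g2(1)]
        lborel_pair.AE_integrable_fst'[OF g3]
    proof eventually_elim
      case (elim x)
      let ?c = "p * dpow p (w x)"
      have M: "integrable lborel (\<lambda>y. k x y * e y)"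
        using elim(2) k_nonneg e0 by (intro integrableI_nonneg) auto
      have MS: "(\<integral>y. k x y * e y \<partial>lborel) = S x * e x"
        using elim(2) k_nonneg e0 S_nonneg by (subst integral_eq_nn_integral) auto
      have kU: "integrable lborel (\<lambda>y. k x y * U y)" using elim(1) by simp
      have "p * (dpow p (w x) * V x) = ?c * ((\<integral>y. k x y * U y \<partial>lborel) - w x * (\<integral>y. k x y * e y \<partial>lborel))"
        using elim(1) by (simp add: MS U_w)
      also have "\<dots> = (\<integral>y. ?c * (k x y * U y - w x * (k x y * e y)) \<partial>lborel)"
        using kU M by simp
      also have "\<dots> \<le> (\<integral>y. g1 (x, y) - g2 (x, y) - g3 (x, y) \<partial>lborel)"
      proof (rule integral_mono)
        fix y
        have "k x y * e y * ((?W y - ?W x)\<^sup>2 + ?c * (w y - w x)) \<le> k x y * e y * (\<bar>w y\<bar> powr p - \<bar>w x\<bar> powr p)"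
          using bregman_lower[OF p, of "w y" "w x"] k_nonneg e0 by (intro mult_left_mono) auto
        then show "?c * (k x y * U y - w x * (k x y * e y)) \<le> g1 (x, y) - g2 (x, y) - g3 (x, y)"
          unfolding g1_def g2_def g3_def U_w prod.case by (simp add: algebra_simps)
      qed (use elim kU M in auto)
      also have "\<dots> = (\<integral>y. g1 (x, y) \<partial>lborel) - (\<integral>y. g2 (x, y) \<partial>lborel) - (\<integral>y. g3 (x, y) \<partial>lborel)"
        using elim by simp
      finally show ?case .
    qed
  qed
  also have "\<dots> = integral\<^sup>L (lborel \<Otimes>\<^sub>M lborel) g1 - integral\<^sup>L (lborel \<Otimes>\<^sub>M lborel) g2 - integral\<^sup>L (lborel \<Otimes>\<^sub>M lborel) g3"
    using g1(1) g2(1) g3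
    by (simp add: lborel_pair.integrable_fst' lborel_pair.integral_fst')
  also have "\<dots> = - dissipation ?W" unfolding g1 g2 by (simp add: g3_def dissipation_def)
  finally show ?thesis by (simp add: w_def)
qed

end

section \<open>Decay for Borel measurable data\<close>

text \<open>The constant of \<open>nonlocal_nash_powr\<close>, for dimension \<open>n\<close>, volume \<open>V\<close> of the ball of radius \<open>R\<close>, bound \<open>A\<close> on the
  \<open>L\<^sup>1\<close> norm and bound \<open>P\<close> on the integral of the \<open>p\<close>-th power.\<close>

definition nash_const :: "real \<Rightarrow> real \<Rightarrow> real \<Rightarrow> real \<Rightarrow> real \<Rightarrow> real" where
  "nash_const n V p A P = 
     V / (4 * (max ((2 * (A + 1)\<^sup>2 / V) powr (1 / n)) (P powr (1 / (n * (p - 1)))))\<^sup>2)"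

text \<open>The constant of the decay estimate, where \<open>E0 > 0\<close> bounds the initial entropy. It does not involve the bound
  on the integrals of the kernel.\<close>

definition decay_const :: "real \<Rightarrow> real \<Rightarrow> real \<Rightarrow> real \<Rightarrow> real \<Rightarrow> real \<Rightarrow> real \<Rightarrow> real" where
  "decay_const n V r m p A E0 =
     (let \<beta> = 2 / (n * (p - 1)); c = r / m * nash_const n V p (m * A) (m * E0) * (1 / m) powr (1 + \<beta>)
      in m powr (p - 1) * min (E0 powr (- \<beta>)) (\<beta> * c) powr (- 1 / \<beta>))"

context balanced_kernel
begin

lemma weight_powr: "e x powr (1 - p) * \<bar>u\<bar> powr p = e x * \<bar>u / e x\<bar> powr p"
  using e_pos[of x] by (simp add: powr_divide powr_diff)

lemma weight_dpow: "e x powr (1 - p) * dpow p u = dpow p (u / e x)"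
  using e_pos[of x] by (simp add: dpow_def powr_divide powr_diff sgn_divide)

lemma quotient_le: "\<bar>u / e x\<bar> \<le> m * \<bar>u\<bar>"
proof -
  have "1 / e x \<le> m" using e_ge[of x] e_pos[of x] m by (simp add: field_simps)
  then show ?thesis using e_pos[of x] mult_right_mono[of "1 / e x" m "\<bar>u\<bar>"] by simp
qed

text \<open>The entropy is \<open>E t = \<integral> e * \<bar>U t / e\<bar> powr p\<close>. Dissipation and the Nash inequality give
  \<open>E' \<le> - c * E powr (1 + \<beta>)\<close> with \<open>\<beta> = 2 / (n * (p - 1))\<close>.\<close>

lemma Lp_decay:
  fixes U V :: "real \<Rightarrow> 'a \<Rightarrow> real"
  assumes p: "2 \<le> p"
    and U [measurable]: "\<And>t. 0 \<le> t \<Longrightarrow> U t \<in> borel_measurable borel"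
    and V [measurable]: "\<And>t. 0 \<le> t \<Longrightarrow> V t \<in> borel_measurable borel"
    and U1: "\<And>t. 0 \<le> t \<Longrightarrow> integrable lborel (U t)" 
    and V1: "\<And>t. 0 \<le> t \<Longrightarrow> integrable lborel (V t)"
    and Up: "\<And>t. 0 \<le> t \<Longrightarrow> integrable lborel (\<lambda>x. \<bar>U t x\<bar> powr p)"
    and Vp: "\<And>t. 0 \<le> t \<Longrightarrow> integrable lborel (\<lambda>x. \<bar>V t x\<bar> powr p)"
    and lim1: "\<And>t. 0 \<le> t \<Longrightarrow> 
      ((\<lambda>s. \<integral>x. \<bar>(U s x - U t x) / (s - t) - V t x\<bar> \<partial>lborel) \<longlongrightarrow> 0) (at t within {0..})"
    and limp: "\<And>t. 0 \<le> t \<Longrightarrow> 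
      ((\<lambda>s. \<integral>x. \<bar>(U s x - U t x) / (s - t) - V t x\<bar> powr p \<partial>lborel) \<longlongrightarrow> 0) (at t within {0..})"
    and eq: "\<And>t. 0 \<le> t \<Longrightarrow> AE x in lborel. integrable lborel (\<lambda>y. k x y * U t y) \<and> 
       V t x = (\<integral>y. k x y * U t y \<partial>lborel) - S x * U t x"
    and A: "(\<integral>x. \<bar>U 0 x\<bar> \<partial>lborel) \<le> A"
    and E0: "0 < E0" "m powr (p - 1) * (\<integral>x. \<bar>U 0 x\<bar> powr p \<partial>lborel) \<le> E0"
    and t: "0 \<le> t"
  shows "(\<integral>x. \<bar>U t x\<bar> powr p \<partial>lborel)
    \<le> decay_const (real DIM('a)) (measure lborel (ball (0::'a) R)) r m p A E0 
      * (1 + t) powr (- (real DIM('a) * (p - 1) / 2))"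
proof -
  define n where "n = real DIM('a)"
  define Vol where "Vol = measure lborel (ball (0::'a) R)"
  define \<beta> where "\<beta> = 2 / (n * (p - 1))"
  define \<kappa> where "\<kappa> = nash_const n Vol p (m * A) (m * E0)"
  define c where "c = r / m * \<kappa> * (1 / m) powr (1 + \<beta>)"
  define \<rho> where "\<rho> x = e x powr (1 - p)" for x
  define w where "w t x = U t x / e x" for t x
  define E where "E t = (\<integral>x. \<rho> x * \<bar>U t x\<bar> powr p \<partial>lborel)" for t
  define E' where "E' t = (\<integral>x. \<rho> x * (p * (dpow p (U t x) * V t x)) \<partial>lborel)" for t
  define diss where "diss t = dissipation (\<lambda>x. \<bar>w t x\<bar> powr (p/2))" for t
  have n: "0 < n" by (simp add: n_def)
  have Vol: "0 < Vol" unfolding Vol_def using R by (rule content_ball_pos)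
  have \<beta>: "0 < \<beta>" using n p by (simp add: \<beta>_def)
  have e0: "0 \<le> e x" for x using e_pos[of x] by simp
  have A0: "0 \<le> A" using A by (rule order_trans[rotated]) simp
  have [measurable]: "\<rho> \<in> borel_measurable borel" unfolding \<rho>_def by measurable
  have w_meas [measurable]: "w t \<in> borel_measurable borel" if "0 \<le> t" for t 
    using U[OF that] unfolding w_def by measurable
  have \<rho>0: "0 \<le> \<rho> x" for x by (simp add: \<rho>_def)
  have \<rho>le: "\<rho> x \<le> (1 / m) powr (1 - p)" for x
    unfolding \<rho>_def using e_ge m p by (intro powr_mono2') auto
  have \<rho>w: "\<rho> x * \<bar>U t x\<bar> powr p = e x * \<bar>w t x\<bar> powr p" for x t
    unfolding \<rho>_def w_def by (rule weight_powr)
  have w_le: "\<bar>w t x\<bar> \<le> m * \<bar>U t x\<bar>" for t x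
    unfolding w_def by (rule quotient_le)
  have wI: "integrable lborel (w t)" if "0 \<le> t" for t
  proof (rule Bochner_Integration.integrable_bound)
    show "integrable lborel (\<lambda>x. m * U t x)" using U1[OF that] by simp
    show "AE x in lborel. norm (w t x) \<le> norm (m * U t x)"
      using w_le m by (intro AE_I2) (simp add: abs_mult)
  qed (use w_meas[OF that] in measurable)
  have wp: "integrable lborel (\<lambda>x. \<bar>w t x\<bar> powr p)" if "0 \<le> t" for t
  proof (rule Bochner_Integration.integrable_bound)
    show "integrable lborel (\<lambda>x. m powr p * \<bar>U t x\<bar> powr p)" using Up[OF that] by simp
    have "\<bar>w t x\<bar> powr p \<le> (m * \<bar>U t x\<bar>) powr p" for x
      using p by (intro powr_mono2 w_le) auto
    then show "AE x in lborel. norm (\<bar>w t x\<bar> powr p) \<le> norm (m powr p * \<bar>U t x\<bar> powr p)"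
      by (simp add: powr_mult)
  qed (use w_meas[OF that] in measurable)
  have E_w: "E t = (\<integral>x. e x * \<bar>w t x\<bar> powr p \<partial>lborel)" for t
    unfolding E_def \<rho>w ..
  have E_nonneg: "0 \<le> E t" for t
    unfolding E_w using e0 by (intro integral_nonneg_AE) auto
  have deriv: "(E has_real_derivative E' t) (at t within {0..})" if t: "0 \<le> t" for t
    unfolding E_def E'_def
    by (rule has_derivative_weighted_Lp_energy[OF p t _ Up _ Vp[OF t] _ \<rho>0 \<rho>le limp[OF t]])
       (use U V t in auto)
  have E'_le: "E' t \<le> - diss t" if t: "0 \<le> t" for t
  proof -
    have "E' t = (\<integral>x. p * (dpow p (U t x / e x) * V t x) \<partial>lborel)"
      unfolding E'_def \<rho>_def weight_dpow[symmetric] by (simp add: mult_ac)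
    also have "\<dots> \<le> - diss t"
      unfolding diss_def w_def using U V t by (intro entropy_dissipation p Up Vp eq) auto
    finally show ?thesis .
  qed
  have diss_nonneg: "0 \<le> diss t" for t unfolding diss_def by (rule dissipation_nonneg)
  have E'_nonpos: "E' t \<le> 0" if "0 \<le> t" for t
    using E'_le[OF that] diss_nonneg[of t] by linarith
  have mono: "E t \<le> E 0" if "0 \<le> t" for t
    by (rule nonincreasing_of_deriv_within[OF deriv E'_nonpos _ that]) simp_all
  have EE0: "E 0 \<le> E0"
  proof -
    have "\<rho> x \<le> m powr (p - 1)" for x
    proof -
      have "(1 / m) powr (1 - p) = m powr (p - 1)" using m by (simp add: powr_divide powr_diff)
      then show ?thesis using \<rho>le[of x] by simp
    qed
    then have "E 0 \<le> (\<integral>x. m powr (p - 1) * \<bar>U 0 x\<bar> powr p \<partial>lborel)"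
      unfolding E_def using Up[of 0] integrable_e[OF wp[of 0]]
      by (intro integral_mono mult_right_mono) (auto simp: \<rho>w)
    then show ?thesis using E0 by simp
  qed
  have L1: "(\<integral>x. \<bar>U t x\<bar> \<partial>lborel) \<le> A" if t: "0 \<le> t" for t
  proof -
    have "(\<integral>x. \<bar>U t x\<bar> \<partial>lborel) \<le> (\<integral>x. \<bar>U 0 x\<bar> \<partial>lborel)"
    proof (rule L1_norm_nonincreasing[where \<eta> = "1 / CK"])
      show "(\<integral>x. \<bar>U t x + h * V t x\<bar> \<partial>lborel) \<le> (\<integral>x. \<bar>U t x\<bar> \<partial>lborel)"
        if "0 \<le> t" "0 \<le> h" "h \<le> 1 / CK" for t h
        using that CK by (intro L1_step(1) U1 V1 eq) (auto simp: field_simps)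
      show "(\<integral>x. \<bar>U t x\<bar> \<partial>lborel) \<le> (\<integral>x. \<bar>U t x - h * V t x\<bar> \<partial>lborel)"
        if "0 \<le> t" "0 \<le> h" for t h
        using that by (intro L1_step(2) U1 V1 eq) auto
    qed (use U1 V1 lim1 CK t in auto)
    then show ?thesis using A by simp
  qed
  have \<kappa>pos: "0 < \<kappa>"
  proof -
    have "0 < (m * E0) powr (1 / (n * (p - 1)))" using m E0 by simp
    then have "0 < max ((2 * (m * A + 1)\<^sup>2 / Vol) powr (1 / n)) ((m * E0) powr (1 / (n * (p - 1))))"
      by (simp add: less_max_iff_disj)
    then show ?thesis unfolding \<kappa>_def nash_const_def using Vol by simp
  qed
  then have cpos: "0 < c" using r m by (simp add: c_def)
  have key: "c * E t powr (1 + \<beta>) \<le> diss t" if t: "0 \<le> t" for t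
  proof -
    define P where "P = (\<integral>x. \<bar>w t x\<bar> powr p \<partial>lborel)"
    have P1: "E t \<le> m * P"
    proof -
      have "E t \<le> (\<integral>x. m * \<bar>w t x\<bar> powr p \<partial>lborel)"
        unfolding E_w using e_le integrable_e[OF wp[OF t]] wp[OF t]
        by (intro integral_mono mult_right_mono) auto
      then show ?thesis by (simp add: P_def)
    qed
    have P2: "P \<le> m * E0"
    proof -
      have "P \<le> (\<integral>x. m * (e x * \<bar>w t x\<bar> powr p) \<partial>lborel)"
        unfolding P_def
      proof (rule integral_mono)
        fix x 
        have "1 \<le> m * e x" using e_ge[of x] m by (simp add: field_simps)
        then have "1 * \<bar>w t x\<bar> powr p \<le> (m * e x) * \<bar>w t x\<bar> powr p" by (rule mult_right_mono) simp
        then show "\<bar>w t x\<bar> powr p \<le> m * (e x * \<bar>w t x\<bar> powr p)" by (simp add: mult.assoc)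
      qed (use integrable_e[OF wp[OF t]] wp[OF t] in auto)
      also have "\<dots> = m * E t" by (simp add: E_w)
      also have "\<dots> \<le> m * E0" using mono[OF t] EE0 m by (intro mult_left_mono) auto
      finally show ?thesis .
    qed
    have w1: "(\<integral>x. \<bar>w t x\<bar> \<partial>lborel) \<le> m * A"
    proof -
      have "(\<integral>x. \<bar>w t x\<bar> \<partial>lborel) \<le> (\<integral>x. m * \<bar>U t x\<bar> \<partial>lborel)"
        using wI[OF t] U1[OF t] w_le by (intro integral_mono) auto
      also have "\<dots> \<le> m * A" using L1[OF t] m by simp
      finally show ?thesis .
    qed
    have "nonlocal_energy R (\<lambda>x. \<bar>w t x\<bar> powr (p/2)) \<le> ennreal (m / r * diss t)"
      unfolding diss_def
    proof (rule nonlocal_energy_le_dissipation)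
      have "(\<bar>w t x\<bar> powr (p/2))\<^sup>2 = \<bar>w t x\<bar> powr p" for x
        by (simp add: power2_eq_square flip: powr_add)
      then show "integrable lborel (\<lambda>x. (\<bar>w t x\<bar> powr (p/2))\<^sup>2)" using wp[OF t] by simp
    qed (use w_meas[OF t] in measurable)
    then have "\<kappa> * P powr (1 + \<beta>) \<le> m / r * diss t"
      unfolding \<kappa>_def \<beta>_def nash_const_def Vol_def n_def
      using w_meas[OF t] wI[OF t] w1 wp[OF t] P2 diss_nonneg[of t] m r
      by (intro nonlocal_nash_powr[OF _ p R _ _ _ P_def _ refl]) auto
    then have "r / m * (\<kappa> * P powr (1 + \<beta>)) \<le> r / m * (m / r * diss t)"
      using r m by (intro mult_left_mono) auto
    then have *: "r / m * (\<kappa> * P powr (1 + \<beta>)) \<le> diss t" using r m by simp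
    have "c * E t powr (1 + \<beta>) = r / m * (\<kappa> * (1 / m * E t) powr (1 + \<beta>))"
      unfolding c_def by (simp only: powr_mult mult_ac)
    also have "\<dots> \<le> r / m * (\<kappa> * P powr (1 + \<beta>))"
      using r m \<kappa>pos P1 E_nonneg[of t] \<beta>
      by (intro mult_left_mono powr_mono2) (auto simp: field_simps)
    finally show ?thesis using * by linarith
  qed
  have "E t \<le> (min (E0 powr (- \<beta>)) (\<beta> * c)) powr (- 1 / \<beta>) * (1 + t) powr (- 1 / \<beta>)"
    using key E'_le
    by (intro power_law_decay[OF \<beta> cpos E0(1) EE0 E_nonneg deriv _ t]) fastforce+
  then have "m powr (p - 1) * E t \<le> m powr (p - 1) * 
      ((min (E0 powr (- \<beta>)) (\<beta> * c)) powr (- 1 / \<beta>) * (1 + t) powr (- 1 / \<beta>))"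
    by (rule mult_left_mono) simp
  moreover have "(\<integral>x. \<bar>U t x\<bar> powr p \<partial>lborel) \<le> m powr (p - 1) * E t"
  proof -
    have "(\<integral>x. \<bar>U t x\<bar> powr p \<partial>lborel) \<le> (\<integral>x. m powr (p - 1) * (\<rho> x * \<bar>U t x\<bar> powr p) \<partial>lborel)"
    proof (rule integral_mono)
      fix x
      have "1 = e x powr (p - 1) * \<rho> x" using e_pos[of x] by (simp add: \<rho>_def flip: powr_add)
      also have "\<dots> \<le> m powr (p - 1) * \<rho> x"
        using \<rho>0 e0 e_le p by (intro mult_right_mono powr_mono2) auto
      finally have "1 * \<bar>U t x\<bar> powr p \<le> m powr (p - 1) * \<rho> x * \<bar>U t x\<bar> powr p"
        by (rule mult_right_mono) simp
      then show "\<bar>U t x\<bar> powr p \<le> m powr (p - 1) * (\<rho> x * \<bar>U t x\<bar> powr p)" by (simp add: mult.assoc)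
    qed (use Up[OF t] integrable_e[OF wp[OF t]] in \<open>auto simp: \<rho>w\<close>)
    then show ?thesis by (simp add: E_def)
  qed
  moreover have "- 1 / \<beta> = - (n * (p - 1) / 2)" using n p by (simp add: \<beta>_def)
  ultimately show ?thesis
    unfolding decay_const_def Let_def c_def[unfolded \<kappa>_def] \<kappa>_def n_def Vol_def \<beta>_def
    by (simp add: mult.assoc)
qed

end

section \<open>Passing to Borel versions\<close>

lemma lborel_of_AE_eq:
  fixes f g :: "'a::euclidean_space \<Rightarrow> real"
  assumes f: "f \<in> borel_measurable lebesgue" and g: "g \<in> borel_measurable borel"
    and eq: "AE x in lborel. f x = g x"
  shows "integrable lebesgue f \<longleftrightarrow> integrable lborel g"
    and "(\<integral>x. f x \<partial>lebesgue) = (\<integral>x. g x \<partial>lborel)"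
proof -
  have g': "g \<in> borel_measurable lborel" using g by simp
  have gl: "g \<in> borel_measurable lebesgue" using g' by (rule measurable_completion)
  have eq': "AE x in lebesgue. f x = g x" using eq by (rule AE_completion)
  show "integrable lebesgue f \<longleftrightarrow> integrable lborel g"
    using integrable_cong_AE[OF f gl eq'] integrable_completion[OF g'] by simp
  show "(\<integral>x. f x \<partial>lebesgue) = (\<integral>x. g x \<partial>lborel)"
    using integral_cong_AE[OF f gl eq'] integral_completion[OF g'] by simp
qed

lemma nn_integral_lborel_of_AE_eq:
  fixes f g :: "'a::euclidean_space \<Rightarrow> real"
  assumes f: "integrable lebesgue f" "\<And>x. 0 \<le> f x" and eq: "AE x in lborel. f x = g x"
  shows "(\<integral>\<^sup>+x. ennreal (g x) \<partial>lborel) = ennreal (\<integral>x. f x \<partial>lebesgue)"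
proof -
  have "(\<integral>\<^sup>+x. ennreal (g x) \<partial>lborel) = (\<integral>\<^sup>+x. ennreal (f x) \<partial>lborel)"
    using eq by (intro nn_integral_cong_AE) auto
  also have "\<dots> = (\<integral>\<^sup>+x. ennreal (f x) \<partial>lebesgue)" by (simp only: nn_integral_completion)
  also have "\<dots> = ennreal (\<integral>x. f x \<partial>lebesgue)" using f by (intro nn_integral_eq_integral) auto
  finally show ?thesis .
qed

text \<open>The set where \<open>Q\<close> fails need not be measurable, so the exchange of the two variables goes through a measurable
  null set.\<close>

lemma AE_lborel_pair:
  fixes Q :: "'a::euclidean_space \<times> 'b::euclidean_space \<Rightarrow> bool"
  assumes "AE z in lborel. Q z"
  shows "AE x in lborel. AE y in lborel. Q (x, y)" and "AE y in lborel. AE x in lborel. Q (x, y)"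
proof -
  have Q: "AE z in lborel \<Otimes>\<^sub>M lborel. Q z" using assms by (simp only: lborel_prod)
  show "AE x in lborel. AE y in lborel. Q (x, y)" using lborel_pair.AE_pair[OF Q] .
  obtain N where N: "N \<in> sets (lborel \<Otimes>\<^sub>M lborel)" "emeasure (lborel \<Otimes>\<^sub>M lborel) N = 0"
      "{z \<in> space (lborel \<Otimes>\<^sub>M lborel). \<not> Q z} \<subseteq> N"
    using Q by (auto elim: AE_E)
  have sub: "(x, y) \<notin> N \<Longrightarrow> Q (x, y)" for x y using N(3) by (auto simp: space_pair_measure)
  have "N \<in> null_sets (lborel \<Otimes>\<^sub>M lborel)" using N by auto
  then have "AE z in lborel \<Otimes>\<^sub>M lborel. z \<notin> N" by (rule AE_not_in)
  then have *: "AE x in lborel. AE y in lborel. (x, y) \<notin> N" by (rule lborel_pair.AE_pair)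
  have "{z \<in> space (lborel \<Otimes>\<^sub>M lborel). (fst z, snd z) \<notin> N} \<in> sets (lborel \<Otimes>\<^sub>M lborel)"
  proof -
    have "{z \<in> space (lborel \<Otimes>\<^sub>M lborel). (fst z, snd z) \<notin> N} = space (lborel \<Otimes>\<^sub>M lborel) - N" by auto
    then show ?thesis by (simp only: sets.compl_sets[OF N(1)])
  qed
  then have "AE y in lborel. AE x in lborel. (x, y) \<notin> N"
    using lborel_pair.AE_commute[of "\<lambda>x y. (x, y) \<notin> N"] * by blast
  then show "AE y in lborel. AE x in lborel. Q (x, y)"
    using sub by (auto elim!: eventually_mono)
qed

lemma Lp_norm_powr:
  assumes "0 < q" shows "Lp_norm q f powr q = (LINT x|lebesgue. \<bar>f x\<bar> powr q)"
proof -
  have "0 \<le> (LINT x|lebesgue. \<bar>f x\<bar> powr q)" by (intro integral_nonneg_AE) auto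
  then show ?thesis using assms by (simp add: Lp_norm_def powr_powr)
qed

lemma borel_version:
  fixes f :: "'a::euclidean_space \<Rightarrow> real"
  assumes "f \<in> borel_measurable lebesgue"
  obtains g where "g \<in> borel_measurable borel" "AE x in lborel. f x = g x"
  using completion_ex_borel_measurable_real[OF assms] by auto

text \<open>The properties of a curve in \<open>C\<^sup>1([0,\<infinity>), L\<^sup>q)\<close> carry over to Borel representatives chosen separately at each
  time; no joint measurability in time and space is needed.\<close>

lemma C1_Lp_borel_version:
  assumes q: "1 \<le> q" and C1: "C1_Lp q u v"
    and U: "\<And>t. 0 \<le> t \<Longrightarrow> U t \<in> borel_measurable borel" "\<And>t. 0 \<le> t \<Longrightarrow> AE x in lborel. u t x = U t x"
    and V: "\<And>t. 0 \<le> t \<Longrightarrow> V t \<in> borel_measurable borel" "\<And>t. 0 \<le> t \<Longrightarrow> AE x in lborel. v t x = V t x"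
    and t: "0 \<le> t"
  shows "integrable lborel (\<lambda>x. \<bar>U t x\<bar> powr q)" and "integrable lborel (\<lambda>x. \<bar>V t x\<bar> powr q)"
    and "((\<lambda>s. \<integral>x. \<bar>(U s x - U t x) / (s - t) - V t x\<bar> powr q \<partial>lborel) \<longlongrightarrow> 0) (at t within {0..})"
proof -
  have u: "u s \<in> borel_measurable lebesgue" "integrable lebesgue (\<lambda>x. \<bar>u s x\<bar> powr q)" if "0 \<le> s" for s
    using C1 that by (auto simp: C1_Lp_def Lp_space_def)
  have v: "v t \<in> borel_measurable lebesgue" "integrable lebesgue (\<lambda>x. \<bar>v t x\<bar> powr q)"
    using C1 t by (auto simp: C1_Lp_def Lp_space_def)
  note [measurable] = U(1)[OF t] V(1)[OF t] u(1)[OF t] v(1)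
  have "integrable lebesgue (\<lambda>x. \<bar>u t x\<bar> powr q) \<longleftrightarrow> integrable lborel (\<lambda>x. \<bar>U t x\<bar> powr q)"
    using U(2)[OF t] by (intro lborel_of_AE_eq) (measurable, auto)
  then show "integrable lborel (\<lambda>x. \<bar>U t x\<bar> powr q)" using u(2)[OF t] by blast
  have "integrable lebesgue (\<lambda>x. \<bar>v t x\<bar> powr q) \<longleftrightarrow> integrable lborel (\<lambda>x. \<bar>V t x\<bar> powr q)"
    using V(2)[OF t] by (intro lborel_of_AE_eq) (measurable, auto)
  then show "integrable lborel (\<lambda>x. \<bar>V t x\<bar> powr q)" using v(2) by blast
  let ?J = "\<lambda>s. \<integral>x. \<bar>(U s x - U t x) / (s - t) - V t x\<bar> powr q \<partial>lborel"
  let ?n = "\<lambda>s. Lp_norm q (\<lambda>x. (u s x - u t x) / (s - t) - v t x)"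
  have eq: "?n s powr q = ?J s" if s: "0 \<le> s" for s
  proof -
    note [measurable] = U(1)[OF s] u(1)[OF s]
    have "?n s powr q = (LINT x|lebesgue. \<bar>(u s x - u t x) / (s - t) - v t x\<bar> powr q)"
      using q by (intro Lp_norm_powr) auto
    also have "\<dots> = ?J s"
    proof (rule lborel_of_AE_eq(2))
      show "AE x in lborel. \<bar>(u s x - u t x) / (s - t) - v t x\<bar> powr q = \<bar>(U s x - U t x) / (s - t) - V t x\<bar> powr q"
        using U(2)[OF s] U(2)[OF t] V(2)[OF t] by eventually_elim simp
    qed measurable
    finally show ?thesis .
  qed
  have "(?n \<longlongrightarrow> 0) (at t within {0..})" using C1 t by (simp add: C1_Lp_def)
  then have "((\<lambda>s. ?n s powr q) \<longlongrightarrow> 0 powr q) (at t within {0..})"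
    using q by (intro tendsto_powr2 tendsto_const) (auto simp: Lp_norm_def)
  then have "((\<lambda>s. ?n s powr q) \<longlongrightarrow> 0) (at t within {0..})" using q by simp
  moreover have "eventually (\<lambda>s. ?n s powr q = ?J s) (at t within {0..})"
    unfolding eventually_at by (rule exI[of _ 1]) (auto intro: eq)
  ultimately show "(?J \<longlongrightarrow> 0) (at t within {0..})" by (rule Lim_transform_eventually)
qed


text \<open>The decay estimate for the original data, with an explicit constant.\<close>

lemma solution_decay:
  fixes K :: "'a::euclidean_space \<Rightarrow> 'a \<Rightarrow> real"
  assumes p: "2 \<le> p" and r: "0 < r" and R: "0 < R" and m: "0 < m" and CK: "0 < CK"
    and K: "is_kernel r R CK K" 
    and equi: "is_equilibrium K u_inf" and bounds: "\<And>x. 1 / m \<le> u_inf x \<and> u_inf x \<le> m"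
    and u0: "u0 \<in> Lp_space 1" "u0 \<in> Lp_space p"
    and sol: "is_solution p K u0 u" and t: "0 \<le> t"
  shows "Lp_norm p (u t) powr p 
    \<le> decay_const (real DIM('a)) (measure lborel (ball (0::'a) R)) r m p (Lp_norm 1 u0) 
         (m powr (p - 1) * Lp_norm p u0 powr p + 1)
      * (1 + t) powr (- (real DIM('a) * (p - 1) / 2))"
proof -
  have K_meas: "(\<lambda>(x, y). K x y) \<in> borel_measurable lebesgue"
    and K0: "\<And>x y. 0 \<le> K x y" and Kband: "\<And>x y. norm (x - y) < R \<Longrightarrow> r \<le> K x y"
    and Krow: "\<And>x. integrable lebesgue (\<lambda>y. K x y)" 
    and Kcol: "\<And>x. integrable lebesgue (\<lambda>y. K y x)" "\<And>x. (LINT y|lebesgue. K y x) \<le> CK"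
    using K by (auto simp: is_kernel_def)
  obtain K' where K'm: "K' \<in> borel_measurable borel" and K'eq: "AE z in lborel. (case z of (x, y) \<Rightarrow> K x y) = K' z"
    using borel_version[OF K_meas] by blast
  \<comment> \<open>The maximum makes the bounds from below valid everywhere for the Borel version.\<close>
  define k where "k x y = max (if norm (x - y) < R then r else 0) (K' (x, y))" for x y
  have k_meas [measurable]: "(\<lambda>(x, y). k x y) \<in> borel_measurable (borel \<Otimes>\<^sub>M borel)"
  proof -
    have [measurable]: "K' \<in> borel_measurable (borel \<Otimes>\<^sub>M borel)" using K'm by (simp add: borel_prod)
    show ?thesis unfolding k_def split_beta by measurable
  qed
  have k_sec [measurable]: "(\<lambda>x. k x y) \<in> borel_measurable borel" "(\<lambda>y. k x y) \<in> borel_measurable borel" for x y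
    using measurable_compose[OF _ k_meas, of "\<lambda>x. (x, y)" borel] measurable_compose[OF _ k_meas, of "\<lambda>y. (x, y)" borel]
    by simp_all
  have "AE z in lborel. (case z of (x, y) \<Rightarrow> K x y) = (case z of (x, y) \<Rightarrow> k x y)"
    using K'eq
  proof eventually_elim
    case (elim z)
    obtain a b where "z = (a, b)" by (cases z)
    then show ?case using elim K0[of a b] Kband[of a b] by (auto simp: k_def max_def)
  qed
  from AE_lborel_pair[OF this] 
  have kK: "AE x in lborel. AE y in lborel. K x y = k x y" "AE y in lborel. AE x in lborel. K x y = k x y"
    by simp_all
  define S where "S y = min CK (enn2real (\<integral>\<^sup>+x. ennreal (k x y) \<partial>lborel))" for y
  have S_meas: "S \<in> borel_measurable borel" unfolding S_def by measurable
  have sig0: "0 \<le> sigma K y" for y unfolding sigma_def using K0 by (intro integral_nonneg_AE) auto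
  have S_sigma: "AE y in lborel. (\<integral>\<^sup>+x. ennreal (k x y) \<partial>lborel) = ennreal (S y) \<and> sigma K y = S y"
    using kK(2)
  proof eventually_elim
    case (elim y)
    have 1: "(\<integral>\<^sup>+x. ennreal (k x y) \<partial>lborel) = ennreal (sigma K y)"
      unfolding sigma_def using nn_integral_lborel_of_AE_eq[OF Kcol(1) K0 elim] .
    then have "sigma K y = S y" 
      unfolding S_def 1 using sig0 Kcol(2)[of y] by (simp add: sigma_def)
    then show ?case using 1 by simp
  qed
  have um: "u_inf \<in> borel_measurable lebesgue" using equi by (simp add: is_equilibrium_def)
  obtain e' where e'm [measurable]: "e' \<in> borel_measurable borel" and e'eq: "AE x in lborel. u_inf x = e' x"
    using borel_version[OF um] by blast
  define e where "e x = min m (max (1 / m) (e' x))" for x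
  have e_meas [measurable]: "e \<in> borel_measurable borel" unfolding e_def by measurable
  have ee: "AE x in lborel. u_inf x = e x"
    using e'eq
  proof eventually_elim
    case (elim x)
    then show ?case using bounds[of x] by (simp add: e_def)
  qed
  have m1: "1 / m \<le> m" using bounds order_trans by blast
  have u_inf0: "0 \<le> u_inf x" for x using bounds[of x] m by (smt (verit) divide_pos_pos)
  have equi': "AE x in lborel. integrable lebesgue (\<lambda>y. K x y * u_inf y) \<and>
        (LINT y|lebesgue. K x y * u_inf y) = sigma K x * u_inf x"
    using equi by (simp add: is_equilibrium_def AE_completion_iff)
  have row: "AE x in lborel. (\<integral>\<^sup>+y. ennreal (k x y * e y) \<partial>lborel) = ennreal (S x * e x)"
    using equi' kK(1) S_sigma ee
  proof eventually_elim
    case (elim x)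
    have "AE y in lborel. K x y * u_inf y = k x y * e y"
      using elim(2) ee by eventually_elim simp
    from nn_integral_lborel_of_AE_eq[OF _ _ this] elim K0 u_inf0 show ?case by simp
  qed
  interpret balanced_kernel k S e m CK r R
    by unfold_locales
       (use k_meas S_meas e_meas r R CK m m1 row S_sigma in \<open>auto simp: k_def S_def e_def max_def min_def\<close>)
  obtain v where C1: "C1_Lp 1 u v" "C1_Lp p u v"
    and eq: "\<And>t. 0 \<le> t \<Longrightarrow> AE x in lebesgue. integrable lebesgue (\<lambda>y. K x y * u t y) \<and>
           v t x = (LINT y|lebesgue. K x y * u t y) - sigma K x * u t x"
    and init: "AE x in lebesgue. u 0 x = u0 x"
    using sol unfolding is_solution_def by blast
  have um: "u t \<in> borel_measurable lebesgue" and vm: "v t \<in> borel_measurable lebesgue" if "0 \<le> t" for t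
    using C1(1) that by (auto simp: C1_Lp_def Lp_space_def)
  have "\<exists>U. \<forall>t\<ge>0. U t \<in> borel_measurable borel \<and> (AE x in lborel. u t x = U t x)"
    using borel_version[OF um] by (intro choice) metis
  then obtain U where U: "\<And>t. 0 \<le> t \<Longrightarrow> U t \<in> borel_measurable borel" 
      "\<And>t. 0 \<le> t \<Longrightarrow> AE x in lborel. u t x = U t x" by blast
  have "\<exists>V. \<forall>t\<ge>0. V t \<in> borel_measurable borel \<and> (AE x in lborel. v t x = V t x)"
    using borel_version[OF vm] by (intro choice) metis
  then obtain V where V: "\<And>t. 0 \<le> t \<Longrightarrow> V t \<in> borel_measurable borel" 
      "\<And>t. 0 \<le> t \<Longrightarrow> AE x in lborel. v t x = V t x" by blast
  have p1: "1 \<le> p" using p by simp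
  note T1 = C1_Lp_borel_version[OF order_refl C1(1) U V, simplified]
  note Tp = C1_Lp_borel_version[OF p1 C1(2) U V]
  have U1: "integrable lborel (U t)" and V1: "integrable lborel (V t)" if "0 \<le> t" for t
    using T1(1,2)[OF that] U(1)[OF that] V(1)[OF that] by (auto simp: integrable_abs_iff)
  have eqB: "AE x in lborel. integrable lborel (\<lambda>y. k x y * U t y) \<and> 
       V t x = (\<integral>y. k x y * U t y \<partial>lborel) - S x * U t x" if t: "0 \<le> t" for t
  proof -
    have "AE x in lborel. integrable lebesgue (\<lambda>y. K x y * u t y) \<and>
           v t x = (LINT y|lebesgue. K x y * u t y) - sigma K x * u t x"
      using eq[OF t] by (simp only: AE_completion_iff)
    then show ?thesis using kK(1) S_sigma U(2)[OF t] V(2)[OF t]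
    proof eventually_elim
      case (elim x)
      have "AE y in lborel. K x y * u t y = k x y * U t y"
        using elim(2) U(2)[OF t] by eventually_elim simp
      moreover have "(\<lambda>y. k x y * U t y) \<in> borel_measurable borel" using U(1)[OF t] by measurable
      moreover have "(\<lambda>y. K x y * u t y) \<in> borel_measurable lebesgue" 
        using elim(1) by (intro borel_measurable_integrable) simp
      ultimately show ?case
        using lborel_of_AE_eq[of "\<lambda>y. K x y * u t y" "\<lambda>y. k x y * U t y"] elim by simp
    qed
  qed
  have u0eq: "AE x in lborel. u0 x = U 0 x"
    using init U(2)[of 0, OF order_refl] unfolding AE_completion_iff by eventually_elim simp
  have u0m [measurable]: "u0 \<in> borel_measurable lebesgue" using u0 by (simp add: Lp_space_def)
  have norm_u0: "(LINT x|lebesgue. \<bar>u0 x\<bar> powr q) = (\<integral>x. \<bar>U 0 x\<bar> powr q \<partial>lborel)" for q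
    using U(1)[of 0] u0eq by (intro lborel_of_AE_eq(2)) (measurable, auto)
  have "(\<integral>x. \<bar>U t x\<bar> powr p \<partial>lborel)
    \<le> decay_const (real DIM('a)) (measure lborel (ball (0::'a) R)) r m p (Lp_norm 1 u0) 
         (m powr (p - 1) * Lp_norm p u0 powr p + 1)
      * (1 + t) powr (- (real DIM('a) * (p - 1) / 2))"
  proof (rule Lp_decay[OF p U(1) V(1) U1 V1 Tp(1,2) T1(3) Tp(3) eqB _ _ _ t])
    show "(\<integral>x. \<bar>U 0 x\<bar> \<partial>lborel) \<le> Lp_norm 1 u0"
      using norm_u0[of 1] by (simp add: Lp_norm_def integral_nonneg_AE)
    \<comment> \<open>The summand 1 makes the entropy bound positive also for vanishing initial data.\<close>
    show "0 < m powr (p - 1) * Lp_norm p u0 powr p + 1"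
      by (smt (verit) mult_nonneg_nonneg powr_ge_zero)
    show "m powr (p - 1) * (\<integral>x. \<bar>U 0 x\<bar> powr p \<partial>lborel) \<le> m powr (p - 1) * Lp_norm p u0 powr p + 1"
      using p by (simp add: Lp_norm_powr norm_u0)
  qed
  moreover have "Lp_norm p (u t) powr p = (\<integral>x. \<bar>U t x\<bar> powr p \<partial>lborel)"
  proof -
    note [measurable] = U(1)[OF t] um[OF t]
    have "(LINT x|lebesgue. \<bar>u t x\<bar> powr p) = (\<integral>x. \<bar>U t x\<bar> powr p \<partial>lborel)"
      using U(2)[OF t] by (intro lborel_of_AE_eq(2)) (measurable, auto)
    then show ?thesis using p by (simp add: Lp_norm_powr)
  qed
  ultimately show ?thesis by simp
qed

theorem theorem1p5:
  fixes p r R m A B :: real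
  assumes "2 \<le> p" and "0 < r" and "0 < R" and "0 < m"
  shows "\<exists>C::real.
    \<forall>(K :: real ^ 'n \<Rightarrow> real ^ 'n \<Rightarrow> real) CK u_inf u0 u.
      0 < CK \<longrightarrow> is_kernel r R CK K \<longrightarrow>
      is_equilibrium K u_inf \<longrightarrow> (\<forall>x. 1 / m \<le> u_inf x \<and> u_inf x \<le> m) \<longrightarrow>
      u0 \<in> Lp_space 1 \<longrightarrow> u0 \<in> Lp_space p \<longrightarrow>
      Lp_norm 1 u0 = A \<longrightarrow> Lp_norm p u0 = B \<longrightarrow>
      is_solution p K u0 u \<longrightarrow>
      (\<forall>t\<ge>0. Lp_norm p (u t) powr p
         \<le> C * (1 + t) powr (- (real CARD('n) * (p - 1) / 2)))"
proof (intro exI allI impI)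
  fix K :: "real ^ 'n \<Rightarrow> real ^ 'n \<Rightarrow> real" and CK u_inf u0 u t
  assume "0 < CK" "is_kernel r R CK K" "is_equilibrium K u_inf" 
    "\<forall>x. 1 / m \<le> u_inf x \<and> u_inf x \<le> m" "u0 \<in> Lp_space 1" "u0 \<in> Lp_space p"
    and AB: "Lp_norm 1 u0 = A" "Lp_norm p u0 = B" 
    and "is_solution p K u0 u" "(0::real) \<le> t"
  with assms have "Lp_norm p (u t) powr p 
    \<le> decay_const (real DIM(real ^ 'n)) (measure lborel (ball (0::real ^ 'n) R)) r m p (Lp_norm 1 u0) 
         (m powr (p - 1) * Lp_norm p u0 powr p + 1)
      * (1 + t) powr (- (real DIM(real ^ 'n) * (p - 1) / 2))"
    by (intro solution_decay) auto
  then show "Lp_norm p (u t) powr p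
     \<le> decay_const (real CARD('n)) (measure lborel (ball (0::real ^ 'n) R)) r m p A 
         (m powr (p - 1) * B powr p + 1)
      * (1 + t) powr (- (real CARD('n) * (p - 1) / 2))"
    unfolding AB by simp
qed

end
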